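(* Let $(W,S)$ be a Coxeter system with $S$ finite. Then the smallest Garside shadow in $(W,S)$ is finite.
   Context: Let $\ell$ be the length function of $(W,S)$. For $w=uv$ in $W$ with $\ell(w)=\ell(u)+\ell(v)$, $u$ is called a prefix of $w$ and $v$ a suffix of $w$. The (right) weak order on $W$ is $u\leq_R w$ iff $u$ is a prefix of $w$. A subset $X\subseteq W$ is bounded if there is $g\in W$ with $x\leq_R g$ for all $x\in X$; every bounded $X$ has a least upper bound $\bigvee X$ for $\leq_R$, called its join. A Garside shadow in $(W,S)$ is a subset $A\subseteq W$ containing $S$ such that (i) if $X\subseteq A$ is bounded then $\bigvee X\in A$, and (ii) every suffix of an element of $A$ is in $A$. The intersection of a family of Garside shadows is a Garside shadow, so there is a smallest Garside shadow in $(W,S)$, namely the intersection of all Garside shadows in $(W,S)$. *)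

theory Defs
  imports "HOL-Algebra.Generated_Groups" "HOL-Algebra.Lattice" "HOL-Library.Extended_Nat"
begin

text \<open>
  A letter \<open>(s, True)\<close> stands for the generator \<open>s\<close>, and \<open>(s, False)\<close> for its formal inverse.
\<close>

type_synonym 'a signed_word = "('a \<times> bool) list"

definition eval_signed :: "('a, 'b) monoid_scheme \<Rightarrow> 'a signed_word \<Rightarrow> 'a" where
  "eval_signed G w =
     foldr (\<lambda>(s, b) x. (if b then s else inv\<^bsub>G\<^esub> s) \<otimes>\<^bsub>G\<^esub> x) w \<one>\<^bsub>G\<^esub>"

text \<open>
  Equality in the group presented by generators \<open>S\<close> and relators \<open>R\<close>: the congruence on signed
  words generated by free cancellation and by deletion of relators.
\<close>

inductive presented_eq :: "'a set \<Rightarrow> 'a signed_word set \<Rightarrow> 'a signed_word \<Rightarrow> 'a signed_word \<Rightarrow> bool"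
  for S :: "'a set" and R :: "'a signed_word set" where
  refl: "presented_eq S R u u"
| sym: "presented_eq S R u v \<Longrightarrow> presented_eq S R v u"
| trans: "presented_eq S R u v \<Longrightarrow> presented_eq S R v w \<Longrightarrow> presented_eq S R u w"
| cancel: "u \<in> lists (S \<times> UNIV) \<Longrightarrow> v \<in> lists (S \<times> UNIV) \<Longrightarrow> s \<in> S \<Longrightarrow>
    presented_eq S R (u @ [(s, b), (s, \<not> b)] @ v) (u @ v)"
| relator: "u \<in> lists (S \<times> UNIV) \<Longrightarrow> v \<in> lists (S \<times> UNIV) \<Longrightarrow> r \<in> R \<Longrightarrow>
    presented_eq S R (u @ r @ v) (u @ v)"

definition has_presentation :: "('a, 'b) monoid_scheme \<Rightarrow> 'a set \<Rightarrow> 'a signed_word set \<Rightarrow> bool" where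
  "has_presentation G S R \<longleftrightarrow>
     group G \<and> S \<subseteq> carrier G \<and> R \<subseteq> lists (S \<times> UNIV) \<and> generate G S = carrier G \<and>
     (\<forall>u \<in> lists (S \<times> UNIV). \<forall>v \<in> lists (S \<times> UNIV).
        eval_signed G u = eval_signed G v \<longleftrightarrow> presented_eq S R u v)"

definition coxeter_matrix :: "'a set \<Rightarrow> ('a \<Rightarrow> 'a \<Rightarrow> enat) \<Rightarrow> bool" where
  "coxeter_matrix S m \<longleftrightarrow>
     (\<forall>s\<in>S. m s s = 1) \<and> (\<forall>s\<in>S. \<forall>t\<in>S. m s t = m t s \<and> (s \<noteq> t \<longrightarrow> 2 \<le> m s t))"

text \<open>
  The relators are the words \<open>(s t)\<^sup>k\<close> with \<open>k = m s t\<close> finite; \<open>m s t = \<infinity>\<close> imposes no relation.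
\<close>

definition coxeter_relators :: "'a set \<Rightarrow> ('a \<Rightarrow> 'a \<Rightarrow> enat) \<Rightarrow> 'a signed_word set" where
  "coxeter_relators S m =
     {concat (replicate k [(s, True), (t, True)]) | s t k. s \<in> S \<and> t \<in> S \<and> m s t = enat k}"

definition coxeter_system :: "('a, 'b) monoid_scheme \<Rightarrow> 'a set \<Rightarrow> bool" where
  "coxeter_system W S \<longleftrightarrow>
     (\<exists>m. coxeter_matrix S m \<and> has_presentation W S (coxeter_relators S m))"

text \<open>
  Words in \<open>S\<close> alone suffice below, since the generators of a Coxeter system are involutions.
\<close>

definition cox_length :: "('a, 'b) monoid_scheme \<Rightarrow> 'a set \<Rightarrow> 'a \<Rightarrow> nat" where
  "cox_length W S w =
     (LEAST n. \<exists>ss \<in> lists S. length ss = n \<and> foldr (\<lambda>s x. s \<otimes>\<^bsub>W\<^esub> x) ss \<one>\<^bsub>W\<^esub> = w)"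

definition reduced_product :: "('a, 'b) monoid_scheme \<Rightarrow> 'a set \<Rightarrow> 'a \<Rightarrow> 'a \<Rightarrow> 'a \<Rightarrow> bool" where
  "reduced_product W S w u v \<longleftrightarrow>
     u \<in> carrier W \<and> v \<in> carrier W \<and> w = u \<otimes>\<^bsub>W\<^esub> v \<and>
     cox_length W S w = cox_length W S u + cox_length W S v"

definition cox_prefix :: "('a, 'b) monoid_scheme \<Rightarrow> 'a set \<Rightarrow> 'a \<Rightarrow> 'a \<Rightarrow> bool" where
  "cox_prefix W S u w \<longleftrightarrow> (\<exists>v. reduced_product W S w u v)"

definition cox_suffix :: "('a, 'b) monoid_scheme \<Rightarrow> 'a set \<Rightarrow> 'a \<Rightarrow> 'a \<Rightarrow> bool" where
  "cox_suffix W S v w \<longleftrightarrow> (\<exists>u. reduced_product W S w u v)"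

definition weak_order :: "('a, 'b) monoid_scheme \<Rightarrow> 'a set \<Rightarrow> 'a gorder" where
  "weak_order W S = \<lparr>carrier = carrier W, eq = (=), le = cox_prefix W S\<rparr>"

definition weak_bounded :: "('a, 'b) monoid_scheme \<Rightarrow> 'a set \<Rightarrow> 'a set \<Rightarrow> bool" where
  "weak_bounded W S X \<longleftrightarrow>
     X \<subseteq> carrier W \<and> (\<exists>g \<in> carrier W. \<forall>x\<in>X. x \<sqsubseteq>\<^bsub>weak_order W S\<^esub> g)"

text \<open>
  The supremum \<open>\<Squnion>\<close> is the join, since every bounded subset has a least upper bound. The empty
  set is bounded and its join is the identity.
\<close>

definition garside_shadow :: "('a, 'b) monoid_scheme \<Rightarrow> 'a set \<Rightarrow> 'a set \<Rightarrow> bool" where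
  "garside_shadow W S A \<longleftrightarrow>
     A \<subseteq> carrier W \<and> S \<subseteq> A \<and>
     (\<forall>X. X \<subseteq> A \<and> weak_bounded W S X \<longrightarrow> \<Squnion>\<^bsub>weak_order W S\<^esub> X \<in> A) \<and>
     (\<forall>w\<in>A. \<forall>v. cox_suffix W S v w \<longrightarrow> v \<in> A)"

definition smallest_garside_shadow :: "('a, 'b) monoid_scheme \<Rightarrow> 'a set \<Rightarrow> 'a set" where
  "smallest_garside_shadow W S = \<Inter> {A. garside_shadow W S A}"

end

theory Submission
  imports Defs Complex_Main "HOL-Library.FuncSet"
begin

text \<open>
  The smallest Garside shadow lies in every Garside shadow, so it suffices to exhibit a finite
  one. The one used here consists of the gates of the cone types of \<open>(W, S)\<close>.

  Let \<open>W\<close> act on the span of the simple roots by its reflection representation. Every root is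
  nonnegative or nonpositive, and the inversion set \<open>Inv w\<close> of the positive roots made
  negative by \<open>w\<inverse>\<close> turns the weak order into inclusion (\<open>cox_prefix_iff\<close>). For a right descent
  \<open>s\<close> of \<open>w\<close> the root \<open>- w \<alpha>\<^sub>s\<close> is the single inversion lost in passing from \<open>w\<close> to \<open>w s\<close>; it
  is called a wall of \<open>w\<close>. An element \<open>g\<close> is a gate if each of its walls \<open>\<tau>\<close> is the only
  common inversion of \<open>g\<close> with some \<open>v\<close>. Equivalently, passing from \<open>g\<close> to any \<open>g s\<close> below it
  enlarges the set of the \<open>v\<close> with \<open>Inv v \<inter> Inv g = {}\<close>, which is the cone type of \<open>g\<inverse>\<close>.

  \<^item> The gates form a Garside shadow. Suffixes are a matter of translating \<open>v\<close>. For joins one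
    has to carry the witness \<open>v\<close> for a wall of a gate \<open>g\<close> up to elements \<open>j\<close> above \<open>g\<close>. This
    is an induction in the rank two cosets met on the way (\<open>wall_propagation\<close>): only linear
    relations \<open>\<gamma> = c a + d b\<close> between the two walls \<open>a\<close>, \<open>b\<close> of \<open>j\<close> and a third root enter,
    together with one reflection that turns a witness for \<open>\<gamma>\<close> into a witness for \<open>a\<close>
    (\<open>gate_propagation_step\<close>). The same induction shows that bounded sets have joins at all
    (\<open>join_exists\<close>).

  \<^item> A gate is determined by its elementary inversions, where a root is elementary if it is the
    only common inversion of two elements. Indeed these determine the cone type, and a gate is
    the least element with its cone type (\<open>gate_minimal\<close>): on a geodesic from a gate to
    another element of the same type, \<open>wall_propagation\<close> forbids leaving the elements above
    the gate.

  \<^item> There are finitely many elementary roots, because these are small in the sense of Brink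
    and Howlett: they dominate no other positive root. Two small roots with inner product at
    least \<open>1\<close> are equal (\<open>dominance\<close>), and roots with inner product strictly between \<open>-1\<close> and
    \<open>1\<close> realise finitely many inner products, since such a pair can be moved into a finite
    standard parabolic subsystem (\<open>finite_bil_values\<close>). A small root is reached from a simple
    one by a chain of simple reflections through small roots. Along the chain the list of
    inner products with the simple roots, with all values \<open>\<le> -1\<close> identified, never repeats, so
    the length of the chain is bounded (\<open>finite_small_roots\<close>).
\<close>

section \<open>Coordinate vectors and alternating words\<close>

text \<open>
  Vectors are plain functions on the generators, so two-term linear combinations are the only
  vector space operation that is needed; linearity of a map means that it commutes with
  \<open>comb\<close>.
\<close>

definition comb :: "real \<Rightarrow> ('a \<Rightarrow> real) \<Rightarrow> real \<Rightarrow> ('a \<Rightarrow> real) \<Rightarrow> 'a \<Rightarrow> real" where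
  "comb x u y v = (\<lambda>q. x * u q + y * v q)"

lemma comb_apply: "comb x u y v q = x * u q + y * v q"
  by (simp add: comb_def)

text \<open>
  The simple root of the generator \<open>s\<close>.
\<close>

definition unit :: "'a \<Rightarrow> 'a \<Rightarrow> real" where
  "unit s = (\<lambda>q. if q = s then 1 else 0)"

lemma unit_apply: "unit s q = (if q = s then 1 else 0)"
  by (simp add: unit_def)

lemma unit_same [simp]: "unit s s = 1"
  by (simp add: unit_def)

definition pos :: "('a \<Rightarrow> real) \<Rightarrow> bool" where "pos v \<longleftrightarrow> (\<forall>q. 0 \<le> v q)"
definition neg :: "('a \<Rightarrow> real) \<Rightarrow> bool" where "neg v \<longleftrightarrow> (\<forall>q. v q \<le> 0)"

text \<open>
  The words \<open>\<dots> s t s t\<close> with \<open>k\<close> letters that end in \<open>t\<close>. The end is fixed because the words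
  act from the right end first.
\<close>

fun alternating :: "'a \<Rightarrow> 'a \<Rightarrow> nat \<Rightarrow> 'a list" where
  "alternating s t 0 = []"
| "alternating s t (Suc k) = alternating t s k @ [t]"

lemma length_alternating [simp]: "length (alternating s t k) = k"
  by (induction s t k rule: alternating.induct) auto

lemma set_alternating: "set (alternating s t k) \<subseteq> {s, t}"
  by (induction s t k rule: alternating.induct) auto

lemma alternating_Cons:
  "alternating s t (Suc k) = (if even k then t else s) # alternating s t k"
proof (induction k arbitrary: s t)
  case 0 then show ?case by simp
next
  case (Suc k)
  have "alternating s t (Suc (Suc k)) = alternating t s (Suc k) @ [t]" by simp
  also have "\<dots> = (if even k then s else t) # alternating t s k @ [t]"
    by (simp only: Suc append_Cons)
  finally show ?case by simp
qed

lemma alternating_add: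
  "alternating s t (j + n) = (if even n then alternating s t j else alternating t s j) @ alternating s t n"
  by (induction n arbitrary: s t) auto

lemma rev_alternating:
  "rev (alternating s t n) = (if odd n then alternating s t n else alternating t s n)"
proof (induction n arbitrary: s t)
  case (Suc n)
  then show ?case using alternating_Cons[of t s n] alternating_Cons[of s t n] by auto
qed simp

lemma alternating_eq_concat: "alternating s t (2 * n) = concat (replicate n [s, t])"
proof (induction n)
  case (Suc n)
  have "alternating s t (2 * Suc n) = alternating s t (2 * n) @ [s, t]" by simp
  also have "\<dots> = concat (replicate n [s, t] @ [[s, t]])" by (simp add: Suc)
  finally show ?case by (simp add: replicate_append_same)
qed simp

section \<open>The bilinear form of a Coxeter matrix and its dihedral subgroups\<close>

locale coxeter_form =
  fixes S :: "'a set" and m :: "'a \<Rightarrow> 'a \<Rightarrow> enat"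
  assumes matrix: "coxeter_matrix S m" and finite_S [simp]: "finite S"
begin

text \<open>
  An infinite \<open>m s t\<close> gets the value \<open>-1 = - cos 0\<close>, the limit of \<open>- cos (\<pi> / k)\<close>.
\<close>

definition entry :: "'a \<Rightarrow> 'a \<Rightarrow> real" where
  "entry s t = (case m s t of enat k \<Rightarrow> - cos (pi / real k) | \<infinity> \<Rightarrow> -1)"

definition bil :: "('a \<Rightarrow> real) \<Rightarrow> ('a \<Rightarrow> real) \<Rightarrow> real" where
  "bil u v = (\<Sum>s\<in>S. \<Sum>t\<in>S. u s * v t * entry s t)"

definition reflect :: "('a \<Rightarrow> real) \<Rightarrow> ('a \<Rightarrow> real) \<Rightarrow> 'a \<Rightarrow> real" where
  "reflect u v = comb 1 v (-2 * bil u v) u"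

definition wact :: "'a list \<Rightarrow> ('a \<Rightarrow> real) \<Rightarrow> 'a \<Rightarrow> real" where
  "wact ss v = foldr (\<lambda>s. reflect (unit s)) ss v"

lemma wact_simps [simp]:
  "wact [] v = v" "wact (s # ss) v = reflect (unit s) (wact ss v)" "wact (xs @ ys) v = wact xs (wact ys v)"
  by (simp_all add: wact_def)

lemma m_same: "s \<in> S \<Longrightarrow> m s s = 1" and m_sym: "s \<in> S \<Longrightarrow> t \<in> S \<Longrightarrow> m s t = m t s"
  and m_ge2: "s \<in> S \<Longrightarrow> t \<in> S \<Longrightarrow> s \<noteq> t \<Longrightarrow> 2 \<le> m s t"
  using matrix by (auto simp: coxeter_matrix_def)

lemma entry_same [simp]: "s \<in> S \<Longrightarrow> entry s s = 1"
  by (simp add: entry_def m_same one_enat_def)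

lemma entry_sym: "s \<in> S \<Longrightarrow> t \<in> S \<Longrightarrow> entry s t = entry t s"
  by (simp add: entry_def m_sym)

lemma m_finite_ge2: "s \<in> S \<Longrightarrow> t \<in> S \<Longrightarrow> s \<noteq> t \<Longrightarrow> m s t = enat n \<Longrightarrow> 2 \<le> n"
  using m_ge2[of s t] by (simp add: numeral_eq_enat)

lemma entry_nonpos: assumes "s \<in> S" "t \<in> S" "s \<noteq> t" shows "entry s t \<le> 0"
proof (cases "m s t")
  case (enat n)
  then have n: "2 \<le> n" using assms m_finite_ge2 by blast
  then have "cos (pi / real n) \<ge> 0"
  proof (intro cos_ge_zero)
    show "pi / real n \<le> pi / 2" using n by (intro divide_left_mono) auto
    have "0 \<le> pi / real n" by simp
    then show "- (pi / 2) \<le> pi / real n" using pi_ge_zero by linarith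
  qed
  then show ?thesis by (simp add: entry_def enat)
qed (simp add: entry_def)

lemma abs_entry_le: "\<bar>entry s t\<bar> \<le> 1"
  by (simp add: entry_def split: enat.split)

lemma bil_sym: "bil u v = bil v u"
proof -
  have "bil u v = (\<Sum>t\<in>S. \<Sum>s\<in>S. u s * v t * entry s t)"
    unfolding bil_def by (rule sum.swap)
  also have "\<dots> = bil v u"
    unfolding bil_def
  proof (intro sum.cong)
    fix s t assume "s \<in> S" "t \<in> S"
    then show "u t * v s * entry t s = v s * u t * entry s t"
      using entry_sym[of s t] by simp
  qed simp_all
  finally show ?thesis .
qed

lemma bil_comb_left: "bil (comb x u y v) w = x * bil u w + y * bil v w"
  by (simp add: bil_def comb_apply sum.distrib sum_distrib_left algebra_simps)

lemma bil_comb_right: "bil w (comb x u y v) = x * bil w u + y * bil w v"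
  using bil_comb_left[of x u y v w] by (simp add: bil_sym)

lemma bil_unit_left: assumes "s \<in> S" shows "bil (unit s) v = (\<Sum>t\<in>S. v t * entry s t)"
proof -
  have "bil (unit s) v = (\<Sum>q\<in>S. if q = s then (\<Sum>t\<in>S. v t * entry s t) else 0)"
    unfolding bil_def by (intro sum.cong) (auto simp: unit_def)
  then show ?thesis using assms by simp
qed

lemma bil_unit_unit: "s \<in> S \<Longrightarrow> t \<in> S \<Longrightarrow> bil (unit s) (unit t) = entry s t"
proof -
  assume *: "s \<in> S" "t \<in> S"
  have "(\<Sum>q\<in>S. unit t q * entry s q) = (\<Sum>q\<in>S. if q = t then entry s t else 0)"
    by (intro sum.cong) (auto simp: unit_def)
  then show ?thesis using * by (simp add: bil_unit_left)
qed

lemma bil_expand: "bil u v = (\<Sum>s\<in>S. u s * bil (unit s) v)"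
  unfolding bil_def[of u v]
  by (intro sum.cong) (simp_all add: bil_unit_left sum_distrib_left mult.assoc)

lemma bil_refl_refl: "bil w w = 1 \<Longrightarrow> bil (reflect w u) (reflect w v) = bil u v"
  by (simp add: reflect_def bil_comb_left bil_comb_right bil_sym[of u w] bil_sym[of v w] algebra_simps)

lemma reflect_involution: "bil w w = 1 \<Longrightarrow> reflect w (reflect w v) = v"
  by (rule ext) (simp add: reflect_def comb_apply bil_comb_left bil_comb_right algebra_simps)

lemma reflect_comb: "reflect w (comb x u y v) = comb x (reflect w u) y (reflect w v)"
  by (rule ext) (simp add: reflect_def comb_apply bil_comb_right algebra_simps)

lemma wact_comb: "wact ss (comb x u y v) = comb x (wact ss u) y (wact ss v)"
  by (induction ss) (simp_all add: reflect_comb)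

lemma unit_norm [simp]: "s \<in> S \<Longrightarrow> bil (unit s) (unit s) = 1"
  by (simp add: bil_unit_unit)

text \<open>
  These are Chebyshev polynomials of the second kind in \<open>- entry s t\<close>, written as
  \<open>sin (k \<theta>) / sin \<theta>\<close> with \<open>\<theta> = \<pi> / m s t\<close> if \<open>m s t\<close> is finite. They are the coordinates of
  the images of the simple root of \<open>s\<close> under alternating words in \<open>s\<close> and \<open>t\<close>, and they are
  nonnegative up to the index \<open>m s t\<close>. This is where the order of \<open>s t\<close> meets the positivity
  of roots.
\<close>

definition coeff :: "'a \<Rightarrow> 'a \<Rightarrow> nat \<Rightarrow> real" where
  "coeff s t k = (case m s t of enat n \<Rightarrow> sin (real k * pi / real n) / sin (pi / real n) | \<infinity> \<Rightarrow> real k)"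

lemma coeff_sym: "s \<in> S \<Longrightarrow> t \<in> S \<Longrightarrow> coeff s t k = coeff t s k"
  by (simp add: coeff_def m_sym)

lemma sin_pi_div_pos: "2 \<le> n \<Longrightarrow> 0 < sin (pi / real n)"
  by (intro sin_gt_zero) (auto simp: field_simps)

lemma coeff_0 [simp]: "coeff s t 0 = 0"
  by (simp add: coeff_def split: enat.split)

lemma coeff_1:
  assumes "s \<in> S" "t \<in> S" "s \<noteq> t" shows "coeff s t (Suc 0) = 1"
  using sin_pi_div_pos m_finite_ge2[OF assms] by (force simp: coeff_def split: enat.split)

lemma coeff_rec:
  shows "coeff s t (Suc (Suc k)) = -2 * entry s t * coeff s t (Suc k) - coeff s t k"
proof (cases "m s t")
  case (enat n)
  define \<theta> where "\<theta> = pi / real n"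
  have "sin (real (Suc (Suc k)) * \<theta>) + sin (real k * \<theta>) = 2 * cos \<theta> * sin (real (Suc k) * \<theta>)"
  proof -
    have "(real (Suc (Suc k)) * \<theta> + real k * \<theta>) / 2 = real (Suc k) * \<theta>"
      "(real (Suc (Suc k)) * \<theta> - real k * \<theta>) / 2 = \<theta>"
      by (simp_all add: field_simps)
    then show ?thesis
      using sin_plus_sin[of "real (Suc (Suc k)) * \<theta>" "real k * \<theta>"] by simp
  qed
  then have *: "sin (real (Suc (Suc k)) * \<theta>) = 2 * cos \<theta> * sin (real (Suc k) * \<theta>) - sin (real k * \<theta>)"
    by simp
  have c: "coeff s t j = sin (real j * \<theta>) / sin \<theta>" for j
    by (simp add: coeff_def enat \<theta>_def)
  show ?thesis unfolding c * by (simp add: entry_def enat \<theta>_def diff_divide_distrib)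
qed (simp add: coeff_def entry_def)

lemma coeff_nonneg:
  assumes "s \<in> S" "t \<in> S" "s \<noteq> t" "enat k \<le> m s t"
  shows "0 \<le> coeff s t k"
proof (cases "m s t")
  case (enat n)
  then have n: "2 \<le> n" "k \<le> n" using assms m_finite_ge2 by auto
  have "real k * pi / real n \<le> pi" using n by (simp add: field_simps)
  then have "0 \<le> sin (real k * pi / real n)"
    by (intro sin_ge_zero) auto
  then show ?thesis using sin_pi_div_pos[OF n(1)] by (simp add: coeff_def enat)
qed (simp add: coeff_def)

lemma coeff_period:
  assumes "s \<in> S" "t \<in> S" "s \<noteq> t" "m s t = enat n"
  shows "coeff s t (2 * n) = 0" "coeff s t (Suc (2 * n)) = 1"
proof -
  have n: "2 \<le> n" using assms m_finite_ge2 by blast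
  then have e: "real (2 * n) * pi / real n = 2 * pi" "real (Suc (2 * n)) * pi / real n = pi / real n + 2 * pi"
    by (auto simp: field_simps)
  have "sin (pi / real n + 2 * pi) = sin (pi / real n)" by (rule sin_periodic)
  then show "coeff s t (2 * n) = 0" "coeff s t (Suc (2 * n)) = 1"
    using sin_pi_div_pos[OF n] unfolding coeff_def assms(4) enat.case e by auto
qed

lemma reflect_plane:
  assumes "s \<in> S" "t \<in> S"
  shows "reflect (unit t) (comb x (unit s) y (unit t)) = comb x (unit s) (-2 * entry s t * x - y) (unit t)"
  using assms by (intro ext) (simp add: reflect_def comb_apply bil_comb_right bil_unit_unit entry_sym[of t s] algebra_simps)

lemma reflect_plane_first:
  assumes "s \<in> S" "t \<in> S"
  shows "reflect (unit s) (comb x (unit s) y (unit t)) = comb (-2 * entry s t * y - x) (unit s) y (unit t)"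
  using assms by (intro ext) (simp add: reflect_def comb_apply bil_comb_right bil_unit_unit algebra_simps)

lemma wact_alternating:
  assumes "s \<in> S" "t \<in> S" "s \<noteq> t"
  shows "wact (alternating s t k) (unit s) =
    (if even k then comb (coeff s t (Suc k)) (unit s) (coeff s t k) (unit t)
     else comb (coeff s t k) (unit s) (coeff s t (Suc k)) (unit t))"
proof (induction k)
  case 0
  show ?case using assms by (auto simp: coeff_1 comb_def)
next
  case (Suc k)
  show ?case
    using Suc assms unfolding alternating_Cons wact_simps
    by (cases "even k") (simp_all add: reflect_plane reflect_plane_first coeff_rec)
qed

lemma wact_orthogonal:
  assumes "set ss \<subseteq> {s, t}" "bil (unit s) v = 0" "bil (unit t) v = 0"
  shows "wact ss v = v"
  using assms(1)
proof (induction ss)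
  case (Cons q ss)
  then have "q = s \<or> q = t" "wact ss v = v" by auto
  then show ?case using assms by (auto simp: reflect_def comb_def)
qed simp

lemma wact_alternating_period:
  assumes "s \<in> S" "t \<in> S" "s \<noteq> t" "m s t = enat n"
  shows "wact (alternating s t (2 * n)) (unit s) = unit s"
        "wact (alternating s t (2 * n)) (unit t) = unit t"
proof -
  note c = coeff_period[OF assms]
  show "wact (alternating s t (2 * n)) (unit s) = unit s"
    unfolding wact_alternating[OF assms(1-3)] c by (simp add: comb_def)
  have n: "2 \<le> n" using assms m_finite_ge2 by blast
  define k where "k = 2 * n - 1"
  have k: "2 * n = Suc k" "odd k" using n by (auto simp: k_def)
  have ck: "coeff t s k = -1"
    using coeff_rec[of s t k] c coeff_sym[of s t k] assms by (simp add: k)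
  have ck': "coeff t s (Suc k) = 0" using c(1) coeff_sym[of s t] assms by (simp add: k)
  have un: "reflect (unit t) (unit t) = comb (-1) (unit t) 0 (unit t)"
    using assms by (auto simp: reflect_def comb_def)
  have "wact (alternating t s k) (unit t) = comb (-1) (unit t) 0 (unit s)"
    using assms wact_alternating[of t s k] k by (simp add: ck ck')
  then have "wact (alternating s t (Suc k)) (unit t) = comb (-1) (comb (-1) (unit t) 0 (unit s)) 0 (comb (-1) (unit t) 0 (unit s))"
    by (simp add: un wact_comb)
  then show "wact (alternating s t (2 * n)) (unit t) = unit t" by (auto simp: k comb_def)
qed

text \<open>
  If \<open>m s t\<close> is finite and \<open>s \<noteq> t\<close>, the form is positive definite on the plane of \<open>s\<close> and \<open>t\<close>,
  so every vector is the sum of a vector of that plane and one orthogonal to it. The word acts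
  trivially on both, by periodicity of the coefficients and by orthogonality.
\<close>

lemma wact_relator:
  assumes "s \<in> S" "t \<in> S" "m s t = enat k"
  shows "wact (concat (replicate k [s, t])) v = v"
proof (cases "s = t")
  case True
  then have "k = 1" using assms m_same by (simp add: one_enat_def)
  then show ?thesis using True assms by (simp add: reflect_involution)
next
  case False
  then have k: "2 \<le> k" using assms m_finite_ge2 by blast
  define c where "c = entry s t"
  have "cos (pi / real k) ^ 2 + sin (pi / real k) ^ 2 = 1" by simp
  moreover have "0 < sin (pi / real k) ^ 2" using sin_pi_div_pos[OF k] by (intro zero_less_power)
  ultimately have "cos (pi / real k) ^ 2 < 1" by linarith
  then have c: "1 - c\<^sup>2 > 0" by (simp add: c_def entry_def assms)
  define a b where "a = bil (unit s) v" and "b = bil (unit t) v"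
  define x y where "x = (a - c * b) / (1 - c\<^sup>2)" and "y = (b - c * a) / (1 - c\<^sup>2)"
  have sol: "x + c * y = a" "c * x + y = b"
  proof -
    have "x + c * y = (1 - c\<^sup>2) * a / (1 - c\<^sup>2)" "c * x + y = (1 - c\<^sup>2) * b / (1 - c\<^sup>2)"
      unfolding x_def y_def times_divide_eq_right add_divide_distrib[symmetric]
      by (simp_all add: algebra_simps power2_eq_square)
    then show "x + c * y = a" "c * x + y = b" using c by simp_all
  qed
  define p where "p = comb x (unit s) y (unit t)"
  define r where "r = comb 1 v (-1) p"
  have "bil (unit s) p = a" "bil (unit t) p = b"
    using assms sol by (simp_all add: p_def bil_comb_right bil_unit_unit entry_sym[of t s] c_def algebra_simps)
  then have r0: "bil (unit s) r = 0" "bil (unit t) r = 0"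
    by (simp_all add: r_def bil_comb_right a_def b_def)
  let ?w = "alternating s t (2 * k)"
  have v: "v = comb 1 r 1 p" by (auto simp: r_def comb_def)
  have wr: "wact ?w r = r" by (rule wact_orthogonal[OF set_alternating r0])
  have wp: "wact ?w p = p"
    using wact_alternating_period[OF assms(1,2) False assms(3)] by (simp only: p_def wact_comb)
  have "wact ?w v = comb 1 (wact ?w r) 1 (wact ?w p)" by (subst v) (rule wact_comb)
  then have "wact ?w v = v" using v wr wp by simp
  then show ?thesis by (simp add: alternating_eq_concat)
qed

lemma wact_presented_eq:
  assumes "presented_eq S (coxeter_relators S m) u v"
  shows "wact (map fst u) x = wact (map fst v) x"
  using assms
proof (induction arbitrary: x)
  case (cancel u v s b)
  then show ?case by (simp add: reflect_involution)
next
  case (relator u v r)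
  then obtain s t k where r: "r = concat (replicate k [(s, True), (t, True)])" "s \<in> S" "t \<in> S" "m s t = enat k"
    by (auto simp: coxeter_relators_def)
  have "map fst r = concat (replicate k [s, t])"
    unfolding r(1) by (simp add: map_concat)
  then show ?case using wact_relator[OF r(2-4)] by simp
qed simp_all

lemma even_length_presented_eq:
  assumes "presented_eq S (coxeter_relators S m) u v"
  shows "even (length u) \<longleftrightarrow> even (length v)"
  using assms
proof induction
  case (relator u v r)
  then obtain s t k where r: "r = concat (replicate k [(s, True), (t, True)])"
    by (auto simp: coxeter_relators_def)
  have "even (length r)" unfolding r by (induction k) auto
  then show ?case by simp
qed auto

end

section \<open>Length and the reflection representation\<close>

lemma pos_comb: "pos u \<Longrightarrow> pos v \<Longrightarrow> 0 \<le> x \<Longrightarrow> 0 \<le> y \<Longrightarrow> pos (comb x u y v)"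
  by (simp add: pos_def comb_apply)

lemma pos_unit [simp]: "pos (unit s)"
  by (simp add: pos_def unit_apply)

lemma pos_uminus [simp]: "pos (- v) \<longleftrightarrow> neg v" and neg_uminus [simp]: "neg (- v) \<longleftrightarrow> pos v"
  by (simp_all add: pos_def neg_def)

locale coxeter = coxeter_form S m for W :: "('a, 'b) monoid_scheme" (structure)
    and S :: "'a set" and m :: "'a \<Rightarrow> 'a \<Rightarrow> enat" +
  assumes presentation: "has_presentation W S (coxeter_relators S m)"
begin

sublocale group W
  using presentation by (simp add: has_presentation_def)

abbreviation len :: "'a \<Rightarrow> nat" where "len \<equiv> cox_length W S"

definition wprod :: "'a list \<Rightarrow> 'a" where
  "wprod ss = foldr (\<lambda>s x. s \<otimes> x) ss \<one>"

lemma S_carrier: "s \<in> S \<Longrightarrow> s \<in> carrier W"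
  using presentation by (auto simp: has_presentation_def)

lemma eval_eq_iff: "u \<in> lists (S \<times> UNIV) \<Longrightarrow> v \<in> lists (S \<times> UNIV) \<Longrightarrow>
    eval_signed W u = eval_signed W v \<longleftrightarrow> presented_eq S (coxeter_relators S m) u v"
  using presentation by (simp add: has_presentation_def)

lemma wprod_simps [simp]: "wprod [] = \<one>" "wprod (s # ss) = s \<otimes> wprod ss"
  by (simp_all add: wprod_def)

lemma wprod_closed [simp]: "set ss \<subseteq> S \<Longrightarrow> wprod ss \<in> carrier W"
  by (induction ss) (auto simp: S_carrier)

lemma wprod_append: "set xs \<subseteq> S \<Longrightarrow> set ys \<subseteq> S \<Longrightarrow> wprod (xs @ ys) = wprod xs \<otimes> wprod ys"
  by (induction xs) (auto simp: S_carrier m_assoc)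

lemma wprod_eq_eval: "wprod ss = eval_signed W (map (\<lambda>s. (s, True)) ss)"
  by (induction ss) (simp_all add: eval_signed_def)

lemma wprod_eq_iff: "set us \<subseteq> S \<Longrightarrow> set vs \<subseteq> S \<Longrightarrow> wprod us = wprod vs \<longleftrightarrow>
    presented_eq S (coxeter_relators S m) (map (\<lambda>s. (s, True)) us) (map (\<lambda>s. (s, True)) vs)"
  unfolding wprod_eq_eval by (rule eval_eq_iff) (auto simp: lists_eq_set)

text \<open>
  The presentation is used in two directions: relators are trivial in \<open>W\<close>, and by
  \<open>wact_presented_eq\<close> and \<open>even_length_presented_eq\<close> whatever is invariant under the relators
  is well defined on \<open>W\<close>.
\<close>

lemma wprod_relator:
  assumes "s \<in> S" "t \<in> S" "m s t = enat k"
  shows "wprod (concat (replicate k [s, t])) = \<one>"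
proof -
  have "map (\<lambda>s. (s, True)) (concat (replicate k [s, t])) = concat (replicate k [(s, True), (t, True)])"
    by (simp add: map_concat)
  moreover have "concat (replicate k [(s, True), (t, True)]) \<in> coxeter_relators S m"
    using assms by (auto simp: coxeter_relators_def)
  ultimately have "presented_eq S (coxeter_relators S m)
      (map (\<lambda>s. (s, True)) (concat (replicate k [s, t]))) (map (\<lambda>s. (s, True)) [])"
    using presented_eq.relator[of "[]" S "[]" _ "coxeter_relators S m"] by fastforce
  moreover have "set (concat (replicate k [s, t])) \<subseteq> S"
    using assms by auto
  ultimately have "wprod (concat (replicate k [s, t])) = wprod []"
    by (subst wprod_eq_iff) auto
  then show ?thesis by simp
qed

lemma S_square: assumes "s \<in> S" shows "s \<otimes> s = \<one>"
  using wprod_relator[of s s 1] assms m_same[OF assms] S_carrier[OF assms] by (simp add: one_enat_def)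

lemma S_inv [simp]: "s \<in> S \<Longrightarrow> inv s = s"
  by (rule inv_equality) (auto simp: S_square S_carrier)

lemma S_cancel_right [simp]: "w \<in> carrier W \<Longrightarrow> s \<in> S \<Longrightarrow> w \<otimes> s \<otimes> s = w"
  by (simp add: m_assoc S_carrier S_square)

lemma S_cancel_left [simp]: "w \<in> carrier W \<Longrightarrow> s \<in> S \<Longrightarrow> s \<otimes> (s \<otimes> w) = w"
  by (simp add: m_assoc[symmetric] S_carrier S_square)

lemma exists_word:
  assumes "w \<in> carrier W" obtains ss where "set ss \<subseteq> S" "wprod ss = w"
proof -
  have "w \<in> generate W S" using assms presentation by (simp add: has_presentation_def)
  then have "\<exists>ss. set ss \<subseteq> S \<and> wprod ss = w"
  proof induction
    case one then show ?case by (intro exI[of _ "[]"]) auto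
  next
    case (incl h) then show ?case by (intro exI[of _ "[h]"]) (auto simp: S_carrier)
  next
    case (inv h) then show ?case by (intro exI[of _ "[h]"]) (auto simp: S_carrier)
  next
    case (eng h1 h2)
    then obtain xs ys where "set xs \<subseteq> S" "wprod xs = h1" "set ys \<subseteq> S" "wprod ys = h2" by blast
    then show ?case by (intro exI[of _ "xs @ ys"]) (auto simp: wprod_append)
  qed
  then show thesis using that by blast
qed

lemma len_wprod_le: assumes "set ss \<subseteq> S" shows "len (wprod ss) \<le> length ss"
  unfolding cox_length_def by (rule Least_le) (use assms in \<open>auto simp: wprod_def lists_eq_set\<close>)

lemma reduced_word:
  assumes "w \<in> carrier W" obtains ss where "set ss \<subseteq> S" "wprod ss = w" "length ss = len w"
proof -
  obtain ss where "set ss \<subseteq> S" "wprod ss = w" using exists_word[OF assms] by blast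
  then have "\<exists>n. \<exists>ss \<in> lists S. length ss = n \<and> foldr (\<lambda>s x. s \<otimes> x) ss \<one> = w"
    unfolding wprod_def lists_eq_set by blast
  from LeastI_ex[OF this] show thesis using that unfolding cox_length_def wprod_def lists_eq_set by blast
qed

lemma len_one [simp]: "len \<one> = 0"
  using len_wprod_le[of "[]"] by simp

lemma len_mult_le: assumes "u \<in> carrier W" "v \<in> carrier W" shows "len (u \<otimes> v) \<le> len u + len v"
proof -
  obtain xs where "set xs \<subseteq> S" "wprod xs = u" "length xs = len u" using reduced_word[OF assms(1)] .
  moreover obtain ys where "set ys \<subseteq> S" "wprod ys = v" "length ys = len v" using reduced_word[OF assms(2)] .
  ultimately show ?thesis using len_wprod_le[of "xs @ ys"] by (simp add: wprod_append)
qed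

lemma len_S_le: "s \<in> S \<Longrightarrow> len s \<le> 1"
  using len_wprod_le[of "[s]"] by (simp add: S_carrier)

lemma len_eq_0: assumes "w \<in> carrier W" "len w = 0" shows "w = \<one>"
  using reduced_word[OF assms(1)] assms(2) by (metis length_0_conv wprod_simps(1))

lemma wprod_rev: "set ss \<subseteq> S \<Longrightarrow> wprod (rev ss) = inv (wprod ss)"
  by (induction ss) (auto simp: wprod_append S_carrier inv_mult_group)

lemma len_inv [simp]: assumes "w \<in> carrier W" shows "len (inv w) = len w"
proof -
  have *: "len (inv w) \<le> len w" if "w \<in> carrier W" for w
  proof -
    obtain ss where "set ss \<subseteq> S" "wprod ss = w" "length ss = len w" using reduced_word[OF \<open>w \<in> carrier W\<close>] .
    then show ?thesis using len_wprod_le[of "rev ss"] by (simp add: wprod_rev)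
  qed
  from *[OF assms] *[of "inv w"] assms show ?thesis by simp
qed

lemma even_length_wprod:
  "set us \<subseteq> S \<Longrightarrow> set vs \<subseteq> S \<Longrightarrow> wprod us = wprod vs \<Longrightarrow> even (length us) = even (length vs)"
  using even_length_presented_eq[of "map (\<lambda>s. (s, True)) us" "map (\<lambda>s. (s, True)) vs"]
  by (simp add: wprod_eq_iff)

text \<open>
  The parity of the length of a word is an invariant of the element it represents, so
  multiplication by a generator cannot preserve the length.
\<close>

lemma len_mult_S_cases:
  assumes "w \<in> carrier W" "s \<in> S"
  shows "len (w \<otimes> s) = len w + 1 \<or> len w = len (w \<otimes> s) + 1"
proof -
  obtain xs where xs: "set xs \<subseteq> S" "wprod xs = w" "length xs = len w" using reduced_word[OF assms(1)] .
  have ws: "w \<otimes> s \<in> carrier W" using assms S_carrier by simp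
  obtain ys where ys: "set ys \<subseteq> S" "wprod ys = w \<otimes> s" "length ys = len (w \<otimes> s)" using reduced_word[OF ws] .
  have "even (length (xs @ [s])) = even (length ys)"
    by (rule even_length_wprod) (use xs ys assms S_carrier in \<open>auto simp: wprod_append\<close>)
  then have "len (w \<otimes> s) \<noteq> len w" using xs ys by auto
  moreover have "len (w \<otimes> s) \<le> len w + 1"
    using len_mult_le[of w s] len_S_le[of s] assms S_carrier by fastforce
  moreover have "len w \<le> len (w \<otimes> s) + 1"
    using len_mult_le[of "w \<otimes> s" s] len_S_le[of s] assms S_carrier by fastforce
  ultimately show ?thesis by linarith
qed

lemma exists_last_letter:
  assumes "w \<in> carrier W" "w \<noteq> \<one>"
  obtains s where "s \<in> S" "len w = len (w \<otimes> s) + 1"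
proof -
  obtain xs where xs: "set xs \<subseteq> S" "wprod xs = w" "length xs = len w" using reduced_word[OF assms(1)] .
  with assms obtain ys s where ys: "xs = ys @ [s]" by (cases xs rule: rev_cases) auto
  then have s: "s \<in> S" "set ys \<subseteq> S" using xs by auto
  then have "w = wprod ys \<otimes> s" using xs ys by (simp add: wprod_append S_carrier)
  then have "w \<otimes> s = wprod ys" using s by simp
  then have "len (w \<otimes> s) < len w" using len_wprod_le[OF s(2)] xs ys by simp
  then show thesis using that[OF s(1)] len_mult_S_cases[OF assms(1) s(1)] by auto
qed

definition act :: "'a \<Rightarrow> ('a \<Rightarrow> real) \<Rightarrow> 'a \<Rightarrow> real" where
  "act w = wact (SOME ss. set ss \<subseteq> S \<and> wprod ss = w)"

lemma act_wprod: assumes "set ss \<subseteq> S" shows "act (wprod ss) = wact ss"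
proof -
  define us where "us = (SOME us. set us \<subseteq> S \<and> wprod us = wprod ss)"
  have us: "set us \<subseteq> S \<and> wprod us = wprod ss"
    unfolding us_def by (rule someI[of _ ss]) (use assms in auto)
  then have "presented_eq S (coxeter_relators S m) (map (\<lambda>s. (s, True)) us) (map (\<lambda>s. (s, True)) ss)"
    using assms wprod_eq_iff by blast
  then have "wact us v = wact ss v" for v
    using wact_presented_eq[of _ _ v] by (fastforce simp: comp_def)
  then show ?thesis unfolding act_def us_def[symmetric] by blast
qed

lemma act_one [simp]: "act \<one> v = v"
  using act_wprod[of "[]"] by simp

lemma act_S: "s \<in> S \<Longrightarrow> act s v = reflect (unit s) v"
  using act_wprod[of "[s]"] by (simp add: S_carrier)

lemma act_mult: assumes "x \<in> carrier W" "y \<in> carrier W" shows "act (x \<otimes> y) v = act x (act y v)"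
proof -
  obtain xs where xs: "set xs \<subseteq> S" "wprod xs = x" using exists_word[OF assms(1)] .
  obtain ys where ys: "set ys \<subseteq> S" "wprod ys = y" using exists_word[OF assms(2)] .
  have "act (wprod (xs @ ys)) v = wact xs (wact ys v)"
    using act_wprod[of "xs @ ys"] xs ys by simp
  then show ?thesis using act_wprod[OF xs(1)] act_wprod[OF ys(1)] xs ys by (simp add: wprod_append)
qed

lemma act_comb: assumes "w \<in> carrier W" shows "act w (comb x u y v) = comb x (act w u) y (act w v)"
proof -
  obtain xs where xs: "set xs \<subseteq> S" "wprod xs = w" using exists_word[OF assms] .
  then show ?thesis using act_wprod[OF xs(1)] by (simp add: wact_comb)
qed

lemma act_uminus: assumes "w \<in> carrier W" shows "act w (- v) = - act w v"
proof -
  have "- u = comb (-1) u 0 u" for u :: "'a \<Rightarrow> real" by (rule ext) (simp add: comb_apply)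
  then show ?thesis using act_comb[OF assms, of "-1" v 0 v] by simp
qed

lemma act_inv [simp]: assumes "w \<in> carrier W"
  shows "act w (act (inv w) v) = v" "act (inv w) (act w v) = v"
  using act_mult[of w "inv w" v] act_mult[of "inv w" w v] assms by simp_all

lemma bil_act [simp]: assumes "w \<in> carrier W" shows "bil (act w u) (act w v) = bil u v"
proof -
  obtain xs where xs: "set xs \<subseteq> S" "wprod xs = w" using exists_word[OF assms] .
  have "bil (wact xs u) (wact xs v) = bil u v" using xs(1)
    by (induction xs) (auto simp: bil_refl_refl)
  then show ?thesis using act_wprod[OF xs(1)] xs(2) by simp
qed

lemma reflect_unit_self: "s \<in> S \<Longrightarrow> reflect (unit s) (unit s) = - unit s"
  by (rule ext) (simp add: reflect_def comb_apply)

lemma act_mult_S_unit: "w \<in> carrier W \<Longrightarrow> s \<in> S \<Longrightarrow> act (w \<otimes> s) (unit s) = - act w (unit s)"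
  by (simp add: act_mult S_carrier act_S reflect_unit_self act_uminus)

lemma alternating_subset: "s \<in> S \<Longrightarrow> t \<in> S \<Longrightarrow> set (alternating s t k) \<subseteq> S"
  using set_alternating[of s t k] by auto

text \<open>
  Cut the relator \<open>(s t)\<^sup>n\<close> in two halves: each is the inverse of the other, and the inverse
  of an alternating word is its reversal.
\<close>

lemma braid_relation:
  assumes "s \<in> S" "t \<in> S" "m s t = enat n"
  shows "wprod (alternating s t n) = wprod (alternating t s n)"
proof -
  let ?A = "wprod (alternating s t n)" and ?B = "wprod (if even n then alternating s t n else alternating t s n)"
  note [simp] = alternating_subset[OF assms(1,2)] alternating_subset[OF assms(2,1)]
  have "alternating s t (2 * n) = (if even n then alternating s t n else alternating t s n) @ alternating s t n"
    using alternating_add[of s t n n] by (simp add: mult_2)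
  then have "?B \<otimes> ?A = \<one>"
    using wprod_relator[OF assms] by (simp add: alternating_eq_concat[symmetric] wprod_append)
  then have "?B = inv ?A" by (intro inv_equality[symmetric]) auto
  also have "\<dots> = wprod (if odd n then alternating s t n else alternating t s n)"
    by (simp add: wprod_rev[symmetric] rev_alternating)
  finally show ?thesis by (cases "even n") auto
qed

text \<open>
  Split off from the right end of \<open>w\<close> a longest possible alternating word in \<open>s\<close> and a right
  descent \<open>t\<close>, leaving \<open>v\<close>. By maximality neither \<open>s\<close> nor \<open>t\<close> is a descent of \<open>v\<close>, so \<open>v\<close>
  sends both simple roots to positive vectors by induction. The alternating word has fewer
  than \<open>m s t\<close> letters, since otherwise a braid relation would make \<open>s\<close> a descent of \<open>w\<close>;
  hence it sends \<open>\<alpha>\<^sub>s\<close> to a nonnegative combination of the two simple roots.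
\<close>

theorem pos_act_unit:
  assumes "w \<in> carrier W" "s \<in> S" "len w < len (w \<otimes> s)"
  shows "pos (act w (unit s))"
  using assms
proof (induction "len w" arbitrary: w s rule: less_induct)
  case less
  note w = less.prems(1) and s = less.prems(2)
  show ?case
  proof (cases "w = \<one>")
    case False
    obtain t where t: "t \<in> S" "len w = len (w \<otimes> t) + 1" using exists_last_letter[OF w False] .
    have st: "s \<noteq> t" using t less.prems by auto
    \<comment> \<open>Lengths of alternating words that can be split off from \<open>w\<close>.\<close>
    define Q where "Q = (\<lambda>k. \<exists>v\<in>carrier W. w = v \<otimes> wprod (alternating s t k) \<and> len w = len v + k)"
    have Q1: "Q 1" unfolding Q_def
      by (rule bexI[of _ "w \<otimes> t"]) (use t w S_carrier in auto)
    have Qb: "\<forall>k. Q k \<longrightarrow> k \<le> len w" by (auto simp: Q_def)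
    obtain k where k: "Q k" "\<And>j. Q j \<Longrightarrow> j \<le> k"
      using ex_has_greatest_nat[of Q 1 "\<lambda>k. k" "Suc (len w)"] Q1 Qb by (metis less_Suc_eq_le)
    have k1: "1 \<le> k" using k(2)[OF Q1] .
    obtain v where v: "v \<in> carrier W" "w = v \<otimes> wprod (alternating s t k)" "len w = len v + k"
      using k(1) unfolding Q_def by blast
    note [simp] = alternating_subset[OF s t(1)] alternating_subset[OF t(1) s] S_carrier
    \<comment> \<open>\<open>x\<close> is the letter that would prolong the word to the left, \<open>y\<close> its first letter.\<close>
    define x where "x = (if even k then t else s)"
    define y where "y = (if even k then s else t)"
    have x: "x \<in> S" and y: "y \<in> S" using s t by (auto simp: x_def y_def)
    have vx: "len v < len (v \<otimes> x)"
    proof (rule ccontr)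
      assume "\<not> len v < len (v \<otimes> x)"
      then have l: "len v = len (v \<otimes> x) + 1" using len_mult_S_cases[OF v(1) x] by auto
      have "wprod (alternating s t (Suc k)) = x \<otimes> wprod (alternating s t k)"
        unfolding alternating_Cons x_def by simp
      then have "w = (v \<otimes> x) \<otimes> wprod (alternating s t (Suc k))"
        using v x by (simp add: m_assoc)
      then have "Q (Suc k)" unfolding Q_def using v x l by (intro bexI[of _ "v \<otimes> x"]) auto
      then show False using k(2) by fastforce
    qed
    have vy: "len v < len (v \<otimes> y)"
    proof (rule ccontr)
      assume "\<not> len v < len (v \<otimes> y)"
      then have l: "len v = len (v \<otimes> y) + 1" using len_mult_S_cases[OF v(1) y] by auto
      obtain j where j: "k = Suc j" using k1 by (cases k) auto
      have "wprod (alternating s t k) = y \<otimes> wprod (alternating s t j)"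
        unfolding j alternating_Cons y_def by simp
      then have "w = (v \<otimes> y) \<otimes> wprod (alternating s t j)"
        using v y by (simp add: m_assoc)
      then have "len w \<le> len (v \<otimes> y) + j"
        using len_mult_le[of "v \<otimes> y" "wprod (alternating s t j)"] v y
          len_wprod_le[of "alternating s t j"] by simp
      then show False using v(3) l j by simp
    qed
    have "len v < len w" using v(3) k1 by simp
    then have "pos (act v (unit x))" "pos (act v (unit y))"
      using less.hyps vx vy x y v(1) by blast+
    then have p: "pos (act v (unit s))" "pos (act v (unit t))"
      by (auto simp: x_def y_def split: if_splits)
    have km: "enat (Suc k) \<le> m s t"
    proof (rule ccontr)
      assume "\<not> enat (Suc k) \<le> m s t"
      then obtain n where n: "m s t = enat n" "n \<le> k" by (cases "m s t") auto
      then have n2: "2 \<le> n" using m_finite_ge2[OF s t(1) st] by blast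
      then obtain i where i: "n = Suc i" by (cases n) auto
      define U where "U = (if even n then alternating s t (k - n) else alternating t s (k - n))"
      have U: "set U \<subseteq> S" "length U = k - n" by (simp_all add: U_def)
      have "alternating s t k = U @ alternating s t n"
        using alternating_add[of s t "k - n" n] n by (simp add: U_def)
      then have "w = v \<otimes> (wprod U \<otimes> wprod (alternating t s n))"
        using v U braid_relation[OF s t(1) n(1)] by (simp add: wprod_append)
      also have "wprod (alternating t s n) = wprod (alternating s t i) \<otimes> s"
        using s by (simp add: i wprod_append)
      finally have "w = v \<otimes> wprod (U @ alternating s t i) \<otimes> s"
        using v U s by (simp add: wprod_append m_assoc)
      then have "w \<otimes> s = v \<otimes> wprod (U @ alternating s t i)"
        using v U s by (simp add: wprod_append)
      then have "len (w \<otimes> s) \<le> len v + (length U + i)"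
        using len_mult_le[of v "wprod (U @ alternating s t i)"] v U
          len_wprod_le[of "U @ alternating s t i"] by simp
      then show False using less.prems(3) v(3) U(2) n(2) i by simp
    qed
    have e: "act w (unit s) = act v (wact (alternating s t k) (unit s))"
      using v act_wprod[of "alternating s t k"] by (simp add: act_mult)
    have "enat k \<le> m s t" using km by (cases "m s t") auto
    then have c: "0 \<le> coeff s t k" "0 \<le> coeff s t (Suc k)"
      using coeff_nonneg[OF s t(1) st] km by blast+
    show ?thesis
      unfolding e wact_alternating[OF s t(1) st]
      using v p c by (auto simp: act_comb intro!: pos_comb)
  qed simp
qed

section \<open>Roots and inversion sets\<close>

definition roots :: "('a \<Rightarrow> real) set" where
  "roots = {act w (unit s) | w s. w \<in> carrier W \<and> s \<in> S}"

definition Inv :: "'a \<Rightarrow> ('a \<Rightarrow> real) set" where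
  "Inv w = {\<beta> \<in> roots. pos \<beta> \<and> neg (act (inv w) \<beta>)}"

definition descent :: "'a \<Rightarrow> 'a \<Rightarrow> bool" where
  "descent w s \<longleftrightarrow> s \<in> S \<and> neg (act w (unit s))"

text \<open>
  If \<open>s\<close> is a descent of \<open>w\<close>, this is the positive root of the reflection \<open>w s w\<inverse>\<close>, which
  exchanges \<open>w\<close> and \<open>w s\<close>.
\<close>

definition wall :: "'a \<Rightarrow> 'a \<Rightarrow> 'a \<Rightarrow> real" where
  "wall w s = - act w (unit s)"

lemma unit_root [simp]: "s \<in> S \<Longrightarrow> unit s \<in> roots"
  unfolding roots_def using act_one[of "unit s"] one_closed by force

lemma act_root [simp]: assumes "w \<in> carrier W" "\<beta> \<in> roots" shows "act w \<beta> \<in> roots"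
proof -
  obtain v s where "v \<in> carrier W" "s \<in> S" "\<beta> = act v (unit s)" using assms by (auto simp: roots_def)
  then have "act w \<beta> = act (w \<otimes> v) (unit s)" "w \<otimes> v \<in> carrier W" using assms by (auto simp: act_mult)
  then show ?thesis using \<open>s \<in> S\<close> unfolding roots_def by blast
qed

lemma root_norm [simp]: "\<beta> \<in> roots \<Longrightarrow> bil \<beta> \<beta> = 1"
  by (auto simp: roots_def)

lemma uminus_root [simp]: assumes "\<beta> \<in> roots" shows "- \<beta> \<in> roots"
proof -
  obtain w s where w: "w \<in> carrier W" "s \<in> S" "\<beta> = act w (unit s)" using assms by (auto simp: roots_def)
  then have "- \<beta> = act w (act s (unit s))" by (simp add: act_S reflect_unit_self act_uminus)
  also have "\<dots> \<in> roots" using w S_carrier by simp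
  finally show ?thesis .
qed

lemma root_not_pos_neg: assumes "\<beta> \<in> roots" "pos \<beta>" "neg \<beta>" shows False
proof -
  have "\<beta> q = 0" for q using assms by (auto simp: pos_def neg_def intro: antisym)
  then have "bil \<beta> \<beta> = 0" by (simp add: bil_def)
  then show False using assms by simp
qed

lemma len_descent_iff:
  assumes "w \<in> carrier W" "s \<in> S"
  shows "len (w \<otimes> s) < len w \<longleftrightarrow> neg (act w (unit s))"
    and "len w < len (w \<otimes> s) \<longleftrightarrow> pos (act w (unit s))"
proof -
  have r: "act w (unit s) \<in> roots" using assms by simp
  have 1: "neg (act w (unit s))" if "len (w \<otimes> s) < len w"
    using pos_act_unit[of "w \<otimes> s" s] that assms S_carrier by (simp add: act_mult_S_unit)
  have 2: "pos (act w (unit s))" if "len w < len (w \<otimes> s)"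
    using pos_act_unit[OF assms that] .
  have "len (w \<otimes> s) < len w \<or> len w < len (w \<otimes> s)" using len_mult_S_cases[OF assms] by linarith
  then show "len (w \<otimes> s) < len w \<longleftrightarrow> neg (act w (unit s))"
    "len w < len (w \<otimes> s) \<longleftrightarrow> pos (act w (unit s))"
    using 1 2 root_not_pos_neg[OF r] by auto
qed

lemma root_cases: assumes "\<beta> \<in> roots" obtains "pos \<beta>" "\<not> neg \<beta>" | "neg \<beta>" "\<not> pos \<beta>"
proof -
  obtain w s where w: "w \<in> carrier W" "s \<in> S" "\<beta> = act w (unit s)" using assms by (auto simp: roots_def)
  then have "pos \<beta> \<or> neg \<beta>"
    using len_descent_iff[of w s] len_mult_S_cases[of w s] by force
  then show thesis using that root_not_pos_neg[OF assms] by blast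
qed

lemma not_pos_iff: "\<beta> \<in> roots \<Longrightarrow> \<not> pos \<beta> \<longleftrightarrow> neg \<beta>" and not_neg_iff: "\<beta> \<in> roots \<Longrightarrow> \<not> neg \<beta> \<longleftrightarrow> pos \<beta>"
  using root_cases by blast+

lemma wact_other: "set ss \<subseteq> I \<Longrightarrow> q \<notin> I \<Longrightarrow> wact ss v q = v q"
  by (induction ss) (auto simp: reflect_def comb_apply unit_apply)

lemma act_S_other: "s \<in> S \<Longrightarrow> q \<noteq> s \<Longrightarrow> act s v q = v q"
  by (simp add: act_S reflect_def comb_apply unit_apply)

lemma root_outside: assumes "\<beta> \<in> roots" "q \<notin> S" shows "\<beta> q = 0"
proof -
  obtain w s where w: "w \<in> carrier W" "s \<in> S" "\<beta> = act w (unit s)" using assms by (auto simp: roots_def)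
  obtain ss where ss: "set ss \<subseteq> S" "wprod ss = w" using exists_word[OF w(1)] .
  then have "\<beta> = wact ss (unit s)" using w act_wprod[OF ss(1)] by simp
  then show ?thesis using wact_other[OF ss(1) assms(2)] assms w(2) by (auto simp: unit_apply)
qed

text \<open>
  All roots have norm \<open>1\<close>.
\<close>

lemma proportional_roots:
  assumes "\<beta> \<in> roots" "\<gamma> \<in> roots" "\<beta> = comb c \<gamma> 0 \<gamma>" "0 \<le> c"
  shows "\<beta> = \<gamma>"
proof -
  have "c * (c * 1) = bil \<beta> \<beta>" using assms(2)
    by (simp add: bil_comb_left bil_comb_right assms(3))
  then have "c\<^sup>2 = 1" using assms(1) by (simp add: power2_eq_square)
  then have "c = 1" using assms(4) by (simp add: power2_eq_1_iff)
  then show ?thesis using assms(3) by (simp add: comb_def)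
qed

text \<open>
  A simple reflection changes a single coordinate, so a positive vector that it makes negative
  has no other nonzero coordinate.
\<close>

lemma simple_neg:
  assumes "\<beta> \<in> roots" "pos \<beta>" "s \<in> S" "neg (act s \<beta>)"
  shows "\<beta> = unit s"
proof (rule proportional_roots)
  show "\<beta> = comb (\<beta> s) (unit s) 0 (unit s)"
  proof
    fix q
    show "\<beta> q = comb (\<beta> s) (unit s) 0 (unit s) q"
    proof (cases "q = s")
      case False
      then have "\<beta> q = 0" using assms act_S_other[of s q \<beta>] by (metis antisym neg_def pos_def)
      then show ?thesis using False by (simp add: comb_apply unit_apply)
    qed (simp add: comb_apply)
  qed
qed (use assms in \<open>auto simp: pos_def\<close>)

lemma InvI: "\<beta> \<in> roots \<Longrightarrow> pos \<beta> \<Longrightarrow> neg (act (inv w) \<beta>) \<Longrightarrow> \<beta> \<in> Inv w"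
  and InvD: "\<beta> \<in> Inv w \<Longrightarrow> \<beta> \<in> roots" "\<beta> \<in> Inv w \<Longrightarrow> pos \<beta>" "\<beta> \<in> Inv w \<Longrightarrow> neg (act (inv w) \<beta>)"
  by (auto simp: Inv_def)

lemma not_in_InvD: "\<beta> \<in> roots \<Longrightarrow> pos \<beta> \<Longrightarrow> w \<in> carrier W \<Longrightarrow> \<beta> \<notin> Inv w \<Longrightarrow> pos (act (inv w) \<beta>)"
  by (auto simp: Inv_def not_neg_iff)

lemma Inv_ascent:
  assumes w: "w \<in> carrier W" and s: "s \<in> S" and p: "pos (act w (unit s))"
  shows "Inv (w \<otimes> s) = insert (act w (unit s)) (Inv w)" "act w (unit s) \<notin> Inv w"
proof -
  have r: "act w (unit s) \<in> roots" using w s by simp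
  have e: "act (inv (w \<otimes> s)) \<beta> = act s (act (inv w) \<beta>)" for \<beta>
    using w s by (simp add: inv_mult_group S_carrier act_mult)
  show "act w (unit s) \<notin> Inv w"
    using InvD(3)[of "act w (unit s)" w] w s root_not_pos_neg[of "unit s"] by auto
  show "Inv (w \<otimes> s) = insert (act w (unit s)) (Inv w)"
  proof (intro equalityI subsetI)
    fix \<beta> assume \<beta>: "\<beta> \<in> Inv (w \<otimes> s)"
    then have *: "\<beta> \<in> roots" "pos \<beta>" "neg (act s (act (inv w) \<beta>))"
      using InvD[OF \<beta>] by (simp_all add: e)
    show "\<beta> \<in> insert (act w (unit s)) (Inv w)"
    proof (cases "neg (act (inv w) \<beta>)")
      case False
      then have "act (inv w) \<beta> = unit s"
        using * w s simple_neg[of "act (inv w) \<beta>" s] by (simp add: not_neg_iff)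
      then have "\<beta> = act w (unit s)" using w act_inv(1)[of w \<beta>] by simp
      then show ?thesis by simp
    qed (use * in \<open>auto intro: InvI\<close>)
  next
    fix \<beta> assume "\<beta> \<in> insert (act w (unit s)) (Inv w)"
    then consider "\<beta> = act w (unit s)" | "\<beta> \<in> Inv w" by blast
    then show "\<beta> \<in> Inv (w \<otimes> s)"
    proof cases
      case 1
      then show ?thesis using p r w s by (intro InvI) (simp_all add: e act_S reflect_unit_self)
    next
      case 2
      note * = InvD[OF 2]
      have "neg (act s (act (inv w) \<beta>))"
      proof (rule ccontr)
        assume "\<not> neg (act s (act (inv w) \<beta>))"
        then have "neg (act s (- act (inv w) \<beta>))" "pos (- act (inv w) \<beta>)"
          using * w s S_carrier by (simp_all add: act_uminus not_neg_iff)
        then have "- act (inv w) \<beta> = unit s" using simple_neg * w s by simp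
        then have "act w (- act (inv w) \<beta>) = act w (unit s)" by simp
        then have "- \<beta> = act w (unit s)" using w by (simp add: act_uminus)
        then have "pos (- \<beta>)" using p by simp
        then have "neg \<beta>" by simp
        then show False using * root_not_pos_neg by blast
      qed
      then show ?thesis using * by (intro InvI) (simp_all add: e)
    qed
  qed
qed

lemma descentD:
  assumes "descent w s" "w \<in> carrier W"
  shows "s \<in> S" "Inv w = insert (wall w s) (Inv (w \<otimes> s))" "wall w s \<notin> Inv (w \<otimes> s)"
    "len w = len (w \<otimes> s) + 1" "wall w s \<in> roots" "pos (wall w s)"
proof -
  show s: "s \<in> S" using assms by (simp add: descent_def)
  have "act (w \<otimes> s) (unit s) = wall w s" using s assms act_mult_S_unit by (simp add: wall_def)
  then show "Inv w = insert (wall w s) (Inv (w \<otimes> s))" "wall w s \<notin> Inv (w \<otimes> s)"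
    using Inv_ascent[of "w \<otimes> s" s] s assms S_carrier by (simp_all add: descent_def wall_def)
  show "len w = len (w \<otimes> s) + 1"
    using len_mult_S_cases[OF assms(2) s] len_descent_iff(1)[OF assms(2) s] assms(1) by (auto simp: descent_def)
  show "wall w s \<in> roots" "pos (wall w s)" using assms by (auto simp: wall_def descent_def)
qed

lemma Inv_one [simp]: "Inv \<one> = {}"
  using root_not_pos_neg by (auto simp: Inv_def)

lemma exists_descent:
  assumes "w \<in> carrier W" "w \<noteq> \<one>" obtains s where "descent w s"
proof -
  obtain s where s: "s \<in> S" "len w = len (w \<otimes> s) + 1" using exists_last_letter[OF assms] .
  then have "descent w s" using len_descent_iff(1)[OF assms(1) s(1)] by (simp add: descent_def)
  then show thesis by (rule that)
qed

lemma finite_card_Inv: "w \<in> carrier W \<Longrightarrow> finite (Inv w) \<and> card (Inv w) = len w"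
proof (induction "len w" arbitrary: w rule: less_induct)
  case less
  show ?case
  proof (cases "w = \<one>")
    case False
    obtain s where s: "descent w s" using exists_descent[OF less.prems False] .
    note d = descentD[OF s less.prems]
    have "finite (Inv (w \<otimes> s)) \<and> card (Inv (w \<otimes> s)) = len (w \<otimes> s)"
      using less.hyps[of "w \<otimes> s"] less.prems d S_carrier by simp
    then show ?thesis using d by simp
  qed simp
qed

lemma finite_Inv [simp]: "w \<in> carrier W \<Longrightarrow> finite (Inv w)"
  and card_Inv: "w \<in> carrier W \<Longrightarrow> card (Inv w) = len w"
  using finite_card_Inv by auto

lemma Inv_unit: "s \<in> S \<Longrightarrow> Inv s = {unit s}"
  using Inv_ascent(1)[of "\<one>" s] S_carrier by simp

lemma Inv_mult_cases:
  assumes "u \<in> carrier W" "v \<in> carrier W"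
  shows "Inv (u \<otimes> v) \<subseteq> Inv u \<union> act u ` Inv v"
proof
  fix \<beta> assume \<beta>: "\<beta> \<in> Inv (u \<otimes> v)"
  then have b: "\<beta> \<in> roots" "pos \<beta>" "neg (act (inv v) (act (inv u) \<beta>))"
    using InvD[OF \<beta>] assms by (simp_all add: inv_mult_group act_mult)
  show "\<beta> \<in> Inv u \<union> act u ` Inv v"
  proof (cases "\<beta> \<in> Inv u")
    case False
    then have "act (inv u) \<beta> \<in> Inv v" using b assms by (intro InvI) (auto simp: not_in_InvD)
    then show ?thesis using assms image_eqI[of \<beta> "act u" "act (inv u) \<beta>" "Inv v"] by simp
  qed simp
qed

text \<open>
  The union on the right of \<open>Inv_mult_cases\<close> has at most \<open>len u + len v\<close> elements; if the
  lengths add, this is the size of \<open>Inv (u \<otimes> v)\<close> and nothing of \<open>Inv u\<close> can be missing.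
\<close>

lemma Inv_prefix_subset:
  assumes "u \<in> carrier W" "v \<in> carrier W" "len (u \<otimes> v) = len u + len v"
  shows "Inv u \<subseteq> Inv (u \<otimes> v)"
proof -
  have f: "finite (Inv u)" "finite (act u ` Inv v)" using assms by auto
  have c: "card (act u ` Inv v) \<le> len v" using card_image_le[of "Inv v" "act u"] card_Inv assms by simp
  have "Inv (u \<otimes> v) = Inv u \<union> act u ` Inv v"
  proof (rule card_subset_eq)
    have "card (Inv u \<union> act u ` Inv v) \<le> len u + len v"
      using card_Un_le[of "Inv u" "act u ` Inv v"] c card_Inv[OF assms(1)] by linarith
    moreover have "card (Inv (u \<otimes> v)) \<le> card (Inv u \<union> act u ` Inv v)"
      using f Inv_mult_cases[OF assms(1,2)] by (intro card_mono) auto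
    ultimately show "card (Inv (u \<otimes> v)) = card (Inv u \<union> act u ` Inv v)"
      using card_Inv[of "u \<otimes> v"] assms by simp
  qed (use f Inv_mult_cases[OF assms(1,2)] in auto)
  then show ?thesis by blast
qed

lemma Inv_left_descent:
  assumes u: "u \<in> carrier W" and s: "s \<in> S" "unit s \<in> Inv u"
  shows "Inv (s \<otimes> u) = act s ` (Inv u - {unit s})" "len u = len (s \<otimes> u) + 1"
proof -
  have e: "act (inv (s \<otimes> u)) \<beta> = act (inv u) (act s \<beta>)" for \<beta>
    using u s by (simp add: inv_mult_group S_carrier act_mult)
  have ss: "act s (act s \<beta>) = \<beta>" for \<beta> using act_inv(1)[of s \<beta>] s S_carrier by simp
  show "Inv (s \<otimes> u) = act s ` (Inv u - {unit s})"
  proof (intro equalityI subsetI)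
    fix \<beta> assume \<beta>: "\<beta> \<in> Inv (s \<otimes> u)"
    note b = InvD[OF \<beta>]
    have "\<beta> \<noteq> unit s"
    proof
      assume *: "\<beta> = unit s"
      have "neg (- act (inv u) (unit s))"
        using b(3) u s unfolding e * by (simp add: act_S reflect_unit_self act_uminus)
      then show False using InvD(3)[OF s(2)] root_not_pos_neg[of "act (inv u) (unit s)"] u s by simp
    qed
    then have "pos (act s \<beta>)" using b s simple_neg[of \<beta> s] S_carrier not_neg_iff[of "act s \<beta>"] by auto
    then have "act s \<beta> \<in> Inv u" using b s S_carrier unfolding e by (intro InvI) auto
    moreover have "act s \<beta> \<noteq> unit s"
    proof
      assume "act s \<beta> = unit s"
      then have "\<beta> = - unit s" using ss[of \<beta>] s by (simp add: act_S reflect_unit_self)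
      then have "neg \<beta>" by simp
      then show False using b root_not_pos_neg by blast
    qed
    ultimately show "\<beta> \<in> act s ` (Inv u - {unit s})" using image_eqI[of \<beta> "act s" "act s \<beta>"] ss[of \<beta>] by simp
  next
    fix \<beta> assume "\<beta> \<in> act s ` (Inv u - {unit s})"
    then obtain \<gamma> where g: "\<beta> = act s \<gamma>" "\<gamma> \<in> Inv u" "\<gamma> \<noteq> unit s" by blast
    note b = InvD[OF g(2)]
    have "pos \<beta>" using g b s simple_neg[of \<gamma> s] S_carrier not_neg_iff[of "act s \<gamma>"] by auto
    then show "\<beta> \<in> Inv (s \<otimes> u)" using b s S_carrier g(1) by (intro InvI) (auto simp: e ss)
  qed
  moreover have "inj_on (act s) X" for X using ss by (metis inj_onI)
  ultimately have "card (Inv (s \<otimes> u)) = card (Inv u) - 1" using s u by (simp add: card_image)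
  moreover have "card (Inv u) > 0" using s u by (auto simp: card_gt_0_iff)
  ultimately show "len u = len (s \<otimes> u) + 1" using card_Inv u s S_carrier by simp
qed

lemma unit_in_Inv_iff:
  assumes "w \<in> carrier W" "s \<in> S" shows "unit s \<in> Inv w \<longleftrightarrow> descent (inv w) s"
  using assms by (auto simp: Inv_def descent_def)

lemma exists_left_descent:
  assumes "w \<in> carrier W" "w \<noteq> \<one>" obtains s where "s \<in> S" "unit s \<in> Inv w"
proof -
  have "inv w \<in> carrier W" "inv w \<noteq> \<one>" using assms by (auto simp: inv_eq_1_iff)
  then obtain s where s: "descent (inv w) s" using exists_descent by blast
  then show thesis using that[of s] assms unit_in_Inv_iff by (auto simp: descent_def)
qed

lemma len_additive_of_Inv_subset:
  assumes "u \<in> carrier W" "w \<in> carrier W" "Inv u \<subseteq> Inv w"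
  shows "len w = len u + len (inv u \<otimes> w)"
  using assms
proof (induction "len u" arbitrary: u w rule: less_induct)
  case less
  note u = less.prems(1) and w = less.prems(2)
  show ?case
  proof (cases "u = \<one>")
    case False
    obtain s where s: "s \<in> S" "unit s \<in> Inv u" using exists_left_descent[OF u False] .
    then have s': "unit s \<in> Inv w" using less.prems by blast
    note du = Inv_left_descent[OF u s] and dw = Inv_left_descent[OF w s(1) s']
    have "Inv (s \<otimes> u) \<subseteq> Inv (s \<otimes> w)" unfolding du dw using less.prems by blast
    then have "len (s \<otimes> w) = len (s \<otimes> u) + len (inv (s \<otimes> u) \<otimes> (s \<otimes> w))"
      using less.hyps[of "s \<otimes> u" "s \<otimes> w"] du u w s S_carrier by simp
    moreover have "inv (s \<otimes> u) \<otimes> (s \<otimes> w) = inv u \<otimes> w"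
      using u w s by (simp add: inv_mult_group S_carrier m_assoc)
    ultimately show ?thesis using du dw by simp
  qed (use w in simp)
qed

lemma cox_prefix_iff: "cox_prefix W S u w \<longleftrightarrow> u \<in> carrier W \<and> w \<in> carrier W \<and> Inv u \<subseteq> Inv w"
proof
  assume "cox_prefix W S u w"
  then show "u \<in> carrier W \<and> w \<in> carrier W \<and> Inv u \<subseteq> Inv w"
    using Inv_prefix_subset by (auto simp: cox_prefix_def reduced_product_def)
next
  assume *: "u \<in> carrier W \<and> w \<in> carrier W \<and> Inv u \<subseteq> Inv w"
  then have "w = u \<otimes> (inv u \<otimes> w)" by (simp add: m_assoc[symmetric])
  then show "cox_prefix W S u w" unfolding cox_prefix_def reduced_product_def
    using * len_additive_of_Inv_subset by (intro exI[of _ "inv u \<otimes> w"]) auto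
qed

lemma Inv_eq_imp_eq:
  assumes "u \<in> carrier W" "w \<in> carrier W" "Inv u = Inv w" shows "u = w"
proof -
  have "len (inv u \<otimes> w) = 0"
    using len_additive_of_Inv_subset[of u w] card_Inv[of u] card_Inv[of w] assms by simp
  then have "inv u \<otimes> w = \<one>" using len_eq_0 assms by simp
  then have "u \<otimes> (inv u \<otimes> w) = u" using assms by simp
  then show ?thesis using assms by (simp add: m_assoc[symmetric])
qed

lemma exists_step_above:
  assumes "g \<in> carrier W" "j \<in> carrier W" "Inv g \<subseteq> Inv j" "g \<noteq> j"
  obtains r where "descent j r" "Inv g \<subseteq> Inv (j \<otimes> r)"
proof -
  define v where "v = inv g \<otimes> j"
  have v: "v \<in> carrier W" "j = g \<otimes> v" using assms by (simp_all add: v_def m_assoc[symmetric])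
  have l: "len j = len g + len v" using len_additive_of_Inv_subset[OF assms(1-3)] by (simp add: v_def)
  have "v \<noteq> \<one>" using v assms by auto
  then obtain r where r: "descent v r" using exists_descent v(1) by blast
  note d = descentD[OF r v(1)]
  have jr: "j \<otimes> r = g \<otimes> (v \<otimes> r)" using v assms d S_carrier by (simp add: m_assoc)
  have "len (j \<otimes> r) \<le> len g + len (v \<otimes> r)" unfolding jr using len_mult_le assms v d S_carrier by simp
  then have l2: "len (j \<otimes> r) < len j" using l d by simp
  then have dj: "descent j r" using len_descent_iff(1)[OF assms(2) d(1)] d(1) by (simp add: descent_def)
  have "len (j \<otimes> r) = len g + len (v \<otimes> r)" using descentD(4)[OF dj assms(2)] l d(4) by simp
  then have "Inv g \<subseteq> Inv (j \<otimes> r)"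
    unfolding jr using assms v d S_carrier by (intro Inv_prefix_subset) auto
  then show thesis using that dj by blast
qed

text \<open>
  Inversion sets of the prefixes of \<open>v\<close> grow by one root at a time; take the first prefix that
  meets \<open>K\<close>.
\<close>

lemma truncate:
  assumes "v \<in> carrier W" "Inv v \<inter> K \<noteq> {}"
  obtains v' \<delta> where "v' \<in> carrier W" "Inv v' \<subseteq> Inv v" "Inv v' \<inter> K = {\<delta>}"
proof -
  have "\<exists>v' \<delta>. v' \<in> carrier W \<and> Inv v' \<subseteq> Inv v \<and> Inv v' \<inter> K = {\<delta>}"
    using assms
  proof (induction "len v" arbitrary: v rule: less_induct)
    case less
    have "v \<noteq> \<one>" using less.prems by auto
    then obtain s where s: "descent v s" using exists_descent less.prems by blast
    note d = descentD[OF s less.prems(1)]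
    show ?case
    proof (cases "Inv (v \<otimes> s) \<inter> K = {}")
      case True
      then have "Inv v \<inter> K = {wall v s}" using d(2) less.prems(2) by auto
      then show ?thesis using less.prems by blast
    next
      case False
      then obtain v' \<delta> where "v' \<in> carrier W \<and> Inv v' \<subseteq> Inv (v \<otimes> s) \<and> Inv v' \<inter> K = {\<delta>}"
        using less.hyps[of "v \<otimes> s"] less.prems d S_carrier by auto
      then show ?thesis using d(2) by blast
    qed
  qed
  then show thesis using that by blast
qed

end

section \<open>Propagation of walls and joins in the weak order\<close>

lemma comb_uminus: "comb x (- u) y (- v) = - comb x u y v"
  by (rule ext) (simp add: comb_apply)

lemma comb_units:
  assumes "s \<noteq> r" "\<And>x. x \<notin> {s, r} \<Longrightarrow> v x = 0"
  shows "v = comb (v s) (unit s) (v r) (unit r)"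
proof
  fix x show "v x = comb (v s) (unit s) (v r) (unit r) x"
    using assms by (cases "x \<in> {s, r}") (auto simp: comb_apply unit_apply)
qed

context coxeter
begin

text \<open>
  Inversion sets have convex complements: \<open>w\<inverse>\<close> keeps a nonnegative combination of two roots
  positive if it keeps both positive.
\<close>

lemma Inv_coclosed:
  assumes "w \<in> carrier W" "a \<in> roots" "pos a" "b \<in> roots" "pos b" "b \<notin> Inv w"
    and "\<gamma> \<in> Inv w" "\<gamma> = comb c a d b" "0 \<le> c" "0 \<le> d"
  shows "a \<in> Inv w"
proof (rule ccontr)
  assume "a \<notin> Inv w"
  then have "pos (act (inv w) a)" "pos (act (inv w) b)" using assms not_in_InvD by auto
  then have "pos (act (inv w) \<gamma>)" using assms by (simp add: act_comb pos_comb)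
  then show False using InvD[OF \<open>\<gamma> \<in> Inv w\<close>] assms(1) root_not_pos_neg[of "act (inv w) \<gamma>"] by auto
qed

text \<open>
  The inversions of \<open>j\<close> outside the plane spanned by the images of the simple roots of \<open>s\<close> and
  \<open>r\<close>. They are common to all elements of the coset of \<open>j\<close> by the subgroup that \<open>s\<close> and \<open>r\<close>
  generate.
\<close>

definition core :: "'a \<Rightarrow> 'a \<Rightarrow> 'a \<Rightarrow> ('a \<Rightarrow> real) set" where
  "core j s r = {\<delta> \<in> Inv j. \<exists>x. x \<notin> {s, r} \<and> act (inv j) \<delta> x \<noteq> 0}"

lemma act_wprod_other:
  "set ys \<subseteq> S \<Longrightarrow> set ys \<subseteq> I \<Longrightarrow> q \<notin> I \<Longrightarrow> act (wprod ys) v q = v q"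
  by (simp add: act_wprod wact_other)

text \<open>
  Let \<open>P q \<gamma>\<close> be a property of walls that holds for the walls of \<open>g\<close>. If \<open>g < j\<close> in the weak
  order, then \<open>g \<le> j r\<close> for some descent \<open>r\<close> of \<open>j\<close>. In the coset of \<open>j\<close> by the subgroup
  generated by \<open>s\<close> and \<open>r\<close>, take an element \<open>q\<close> of least length above \<open>g\<close>. It is shorter than
  \<open>j\<close> and has a wall \<open>\<gamma>\<close> among the inversions of \<open>g\<close>, so induction applies to \<open>q\<close> and \<open>\<gamma>\<close>.
  Being a positive root in the plane of the two walls of \<open>j\<close>, \<open>\<gamma>\<close> is a nonnegative combination
  of them. The step from \<open>P q \<gamma>\<close> to the wall of \<open>j\<close> is then a statement about three roots in a
  plane.
\<close>

lemma wall_propagation: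
  assumes g: "g \<in> carrier W"
    and base: "\<And>s. descent g s \<Longrightarrow> P g (wall g s)"
    and step: "\<And>j s r q \<gamma> c d. \<lbrakk>j \<in> carrier W; descent j s; descent j r; s \<noteq> r;
      wall j s \<in> Inv g; wall j r \<notin> Inv g; q \<in> carrier W; core j s r \<subseteq> Inv q;
      \<gamma> \<in> Inv g; \<gamma> = comb c (wall j s) d (wall j r); 0 \<le> c; 0 \<le> d; P q \<gamma>\<rbrakk> \<Longrightarrow> P j (wall j s)"
    and j: "j \<in> carrier W" "Inv g \<subseteq> Inv j" "descent j s" "wall j s \<in> Inv g"
  shows "P j (wall j s)"
  using j
proof (induction "len j" arbitrary: j s rule: less_induct)
  case less
  note j = less.prems
  show ?case
  proof (cases "g = j")
    case False
    obtain r where r: "descent j r" "Inv g \<subseteq> Inv (j \<otimes> r)" using exists_step_above[OF g j(1,2) False] .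
    note ds = descentD[OF j(3,1)] and dr = descentD[OF r(1) j(1)]
    define a where "a = wall j s"
    define b where "b = wall j r"
    have bg: "b \<notin> Inv g" using r dr by (auto simp: b_def)
    have sr: "s \<noteq> r" using bg j(4) by (auto simp: b_def)
    \<comment> \<open>The elements of the rank two coset of \<open>j\<close> that lie above \<open>g\<close>.\<close>
    define Q where "Q = (\<lambda>q. \<exists>ys. set ys \<subseteq> {s, r} \<and> q = j \<otimes> wprod ys \<and> Inv g \<subseteq> Inv q)"
    have Qr: "Q (j \<otimes> r)" unfolding Q_def
      by (rule exI[of _ "[r]"]) (use r dr S_carrier in simp)
    obtain q where q: "Q q" "\<And>q'. Q q' \<Longrightarrow> len q \<le> len q'"
      using ex_has_least_nat[of Q "j \<otimes> r" len] Qr by blast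
    obtain ys where ys: "set ys \<subseteq> {s, r}" "q = j \<otimes> wprod ys" "Inv g \<subseteq> Inv q"
      using q(1) unfolding Q_def by blast
    have ysS: "set ys \<subseteq> S" using ys ds dr by auto
    have qc: "q \<in> carrier W" using ys ysS j by simp
    have inv_q: "act (inv q) \<delta> = act (wprod (rev ys)) (act (inv j) \<delta>)" for \<delta>
      using ys(2) ysS j(1) by (simp add: inv_mult_group act_mult wprod_rev)
    have inv_q_other: "act (inv q) \<delta> x = act (inv j) \<delta> x" if "x \<notin> {s, r}" for \<delta> x
      unfolding inv_q by (rule act_wprod_other[of _ "{s, r}"]) (use ysS ys that in auto)
    have q_plane: "act q \<epsilon> = comb (\<epsilon> s) (act q (unit s)) (\<epsilon> r) (act q (unit r))"
      if "\<And>x. x \<notin> {s, r} \<Longrightarrow> \<epsilon> x = 0" for \<epsilon>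
    proof -
      have "\<epsilon> = comb (\<epsilon> s) (unit s) (\<epsilon> r) (unit r)" by (rule comb_units[OF sr]) (rule that)
      from arg_cong[OF this, of "act q"] show ?thesis using qc by (simp only: act_comb)
    qed
    have "\<exists>t\<in>{s, r}. descent q t"
    proof (rule ccontr)
      assume "\<not> ?thesis"
      then have p: "pos (act q (unit s))" "pos (act q (unit r))"
        using ds(1) dr(1) qc by (auto simp: descent_def not_neg_iff)
      \<comment> \<open>Without such a descent \<open>q\<close> would keep positive all positive roots of the plane of \<open>s\<close> and \<open>r\<close>, and
        \<open>a\<close> could not be an inversion of \<open>q\<close>.\<close>
      define \<epsilon> where "\<epsilon> = - act (inv q) a"
      have "a \<in> Inv q" using ys j by (auto simp: a_def)
      then have "pos \<epsilon>" using InvD(3) by (simp add: \<epsilon>_def)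
      have "\<epsilon> x = 0" if "x \<notin> {s, r}" for x
        using inv_q_other[OF that, of a] that j by (simp add: \<epsilon>_def a_def wall_def act_uminus unit_apply)
      then have "act q \<epsilon> = comb (\<epsilon> s) (act q (unit s)) (\<epsilon> r) (act q (unit r))" by (rule q_plane)
      then have "pos (act q \<epsilon>)" using p \<open>pos \<epsilon>\<close> by (auto simp: pos_def comb_apply)
      moreover have "act q \<epsilon> = - a" using qc by (simp add: \<epsilon>_def act_uminus)
      ultimately have "neg a" by simp
      then show False using ds root_not_pos_neg a_def by blast
    qed
    then obtain t where t: "t \<in> {s, r}" "descent q t" by blast
    note dt = descentD[OF t(2) qc]
    define \<gamma> where "\<gamma> = wall q t"
    have "\<not> Q (q \<otimes> t)" using q(2)[of "q \<otimes> t"] dt by auto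
    moreover have "q \<otimes> t = j \<otimes> wprod (ys @ [t])"
      using ys ysS j dt S_carrier by (simp add: wprod_append m_assoc)
    moreover have "set (ys @ [t]) \<subseteq> {s, r}" using ys t by auto
    ultimately have "\<not> Inv g \<subseteq> Inv (q \<otimes> t)" unfolding Q_def by blast
    then have \<gamma>g: "\<gamma> \<in> Inv g" using ys(3) dt by (auto simp: \<gamma>_def)
    have "len q \<le> len (j \<otimes> r)" using q(2) Qr by blast
    then have "len q < len j" using dr by simp
    then have Pq: "P q \<gamma>" unfolding \<gamma>_def
      by (rule less.hyps) (use qc ys t \<gamma>g \<gamma>_def in auto)
    define \<epsilon> where "\<epsilon> = act (wprod ys) (unit t)"
    have \<epsilon>: "\<epsilon> x = 0" if "x \<notin> {s, r}" for x
      using act_wprod_other[OF ysS ys(1) that, of "unit t"] that t by (auto simp: \<epsilon>_def unit_apply)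
    have \<epsilon>r: "\<epsilon> \<in> roots" using ysS dt by (simp add: \<epsilon>_def)
    have "\<gamma> = - act j \<epsilon>" using ys ysS j by (simp add: \<gamma>_def wall_def \<epsilon>_def act_mult)
    also have "act j \<epsilon> = comb (\<epsilon> s) (act j (unit s)) (\<epsilon> r) (act j (unit r))"
    proof -
      have "\<epsilon> = comb (\<epsilon> s) (unit s) (\<epsilon> r) (unit r)" by (rule comb_units[OF sr]) (rule \<epsilon>)
      from arg_cong[OF this, of "act j"] show ?thesis using j by (simp only: act_comb)
    qed
    finally have \<gamma>: "\<gamma> = comb (\<epsilon> s) a (\<epsilon> r) b" by (simp only: a_def b_def wall_def comb_uminus)
    have "pos \<epsilon>"
    proof (rule ccontr)
      assume "\<not> pos \<epsilon>"
      then have "neg \<epsilon>" using \<epsilon>r not_pos_iff by blast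
      then have "neg \<gamma>" unfolding \<gamma> using ds(6) dr(6)
        by (auto simp: neg_def pos_def comb_apply a_def b_def mult_nonpos_nonneg add_nonpos_nonpos)
      then show False using dt root_not_pos_neg \<gamma>_def by blast
    qed
    then have nn: "0 \<le> \<epsilon> s" "0 \<le> \<epsilon> r" by (auto simp: pos_def)
    have "core j s r \<subseteq> Inv q"
    proof
      fix \<delta> assume "\<delta> \<in> core j s r"
      then obtain x where x: "\<delta> \<in> Inv j" "x \<notin> {s, r}" "act (inv j) \<delta> x \<noteq> 0" by (auto simp: core_def)
      then have "act (inv q) \<delta> x < 0"
        using InvD(3)[OF x(1)] inv_q_other[OF x(2)] by (auto simp: neg_def less_le)
      then have "\<not> pos (act (inv q) \<delta>)" by (auto simp: pos_def not_le)
      then show "\<delta> \<in> Inv q" using InvD[OF x(1)] qc by (intro InvI) (simp_all add: not_pos_iff)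
    qed
    then show ?thesis
      using step[OF j(1,3) r(1) sr j(4) _ qc _ \<gamma>g _ nn Pq] bg \<gamma> by (simp add: a_def b_def)
  qed (use base j in blast)
qed

text \<open>
  Induction along a geodesic from \<open>g\<close> to \<open>p\<close>: each step crosses one of the roots that separate
  the current element from \<open>p\<close>.
\<close>

lemma toward_induct:
  assumes "g \<in> carrier W" "p \<in> carrier W" "C g"
    and up: "\<And>z s. \<lbrakk>z \<in> carrier W; C z; s \<in> S; pos (act z (unit s)); act z (unit s) \<in> Inv p\<rbrakk> \<Longrightarrow> C (z \<otimes> s)"
    and down: "\<And>z s. \<lbrakk>z \<in> carrier W; C z; descent z s; wall z s \<notin> Inv p\<rbrakk> \<Longrightarrow> C (z \<otimes> s)"
  shows "C p"
  using assms(1,3)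
proof (induction "len (inv g \<otimes> p)" arbitrary: g rule: less_induct)
  case (less z)
  note z = less.prems(1)
  show ?case
  proof (cases "inv z \<otimes> p = \<one>")
    case True
    then have "z \<otimes> (inv z \<otimes> p) = z" using z by simp
    then have "p = z" using z assms(2) by (simp add: m_assoc[symmetric])
    then show ?thesis using less.prems by simp
  next
    case False
    define x where "x = inv z \<otimes> p"
    have x: "x \<in> carrier W" "x \<noteq> \<one>" using False z assms(2) by (auto simp: x_def)
    obtain s where s: "s \<in> S" "unit s \<in> Inv x" using exists_left_descent[OF x] .
    have "inv (z \<otimes> s) \<otimes> p = s \<otimes> x"
      using z s assms(2) S_carrier by (simp add: inv_mult_group m_assoc x_def)
    then have l: "len (inv (z \<otimes> s) \<otimes> p) < len (inv z \<otimes> p)"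
      using Inv_left_descent(2)[OF x(1) s] by (simp add: x_def)
    have e: "neg (act (inv p) (act z (unit s)))"
      using InvD(3)[OF s(2)] z assms(2) by (simp add: x_def inv_mult_group act_mult)
    have "C (z \<otimes> s)"
    proof (cases "pos (act z (unit s))")
      case True
      then have "act z (unit s) \<in> Inv p" using e z s by (intro InvI) auto
      then show ?thesis using up z less.prems s True by blast
    next
      case False
      then have d: "descent z s" using s z not_pos_iff by (simp add: descent_def)
      moreover have "wall z s \<notin> Inv p"
      proof
        assume "wall z s \<in> Inv p"
        from InvD(3)[OF this] have "pos (act (inv p) (act z (unit s)))"
          using assms(2) by (simp add: wall_def act_uminus)
        then show False using e root_not_pos_neg[of "act (inv p) (act z (unit s))"] z s assms(2) by simp
      qed
      ultimately show ?thesis using down z less.prems by blast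
    qed
    then show ?thesis using less.hyps[OF l] z s S_carrier by simp
  qed
qed

text \<open>
  An upper bound \<open>g\<close> of least length lies below every upper bound \<open>p\<close>. Walk from \<open>g\<close> to \<open>p\<close>;
  the upper bounds met on the way stay above \<open>g\<close>, because each wall of \<open>g\<close> is an inversion of
  some \<open>x \<in> X\<close> by minimality, \<open>wall_propagation\<close> extends this to the inversions of \<open>g\<close> that
  are walls of elements above \<open>g\<close>, and such an inversion is shared by \<open>p\<close> and hence not
  crossed.
\<close>

lemma join_exists:
  assumes X: "X \<subseteq> carrier W" and u: "u \<in> carrier W" "\<And>x. x \<in> X \<Longrightarrow> Inv x \<subseteq> Inv u"
  obtains g where "g \<in> carrier W" "\<And>x. x \<in> X \<Longrightarrow> Inv x \<subseteq> Inv g"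
    "\<And>p. p \<in> carrier W \<Longrightarrow> (\<And>x. x \<in> X \<Longrightarrow> Inv x \<subseteq> Inv p) \<Longrightarrow> Inv g \<subseteq> Inv p"
proof -
  define U where "U = (\<lambda>z. z \<in> carrier W \<and> (\<forall>x\<in>X. Inv x \<subseteq> Inv z))"
  obtain g where g: "U g" "\<And>z. U z \<Longrightarrow> len g \<le> len z"
    using ex_has_least_nat[of U u len] u by (auto simp: U_def)
  have gc: "g \<in> carrier W" using g by (simp add: U_def)
  have lost: "\<exists>x\<in>X. wall z s \<in> Inv x" if Uz: "U z" and zs: "descent z s" and nU: "\<not> U (z \<otimes> s)" for z s
  proof -
    have z: "z \<in> carrier W" using Uz by (simp add: U_def)
    note d = descentD[OF zs z]
    obtain x where "x \<in> X" "\<not> Inv x \<subseteq> Inv (z \<otimes> s)"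
      using nU z d(1) S_carrier by (auto simp: U_def)
    moreover have "Inv x \<subseteq> Inv z" using Uz \<open>x \<in> X\<close> by (simp add: U_def)
    ultimately show ?thesis using d(2) by auto
  qed
  have base: "\<exists>x\<in>X. wall g s \<in> Inv x" if s: "descent g s" for s
  proof -
    have "\<not> U (g \<otimes> s)" using g(2)[of "g \<otimes> s"] descentD(4)[OF s gc] by auto
    then show ?thesis using lost g(1) s by blast
  qed
  have "Inv g \<subseteq> Inv p" if p: "p \<in> carrier W" "\<And>x. x \<in> X \<Longrightarrow> Inv x \<subseteq> Inv p" for p
  proof -
    have "U p \<and> Inv g \<subseteq> Inv p"
    proof (rule toward_induct[OF gc p(1)])
      show "U g \<and> Inv g \<subseteq> Inv g" using g by simp
    next
      fix z s assume z: "z \<in> carrier W" "U z \<and> Inv g \<subseteq> Inv z" "s \<in> S" "pos (act z (unit s))"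
      then show "U (z \<otimes> s) \<and> Inv g \<subseteq> Inv (z \<otimes> s)"
        using Inv_ascent(1)[of z s] S_carrier unfolding U_def by auto
    next
      fix z s assume z: "z \<in> carrier W" "U z \<and> Inv g \<subseteq> Inv z" and s: "descent z s" "wall z s \<notin> Inv p"
      note d = descentD[OF s(1) z(1)]
      have "U (z \<otimes> s)" using lost[of z s] z s p(2) by blast
      moreover have "wall z s \<notin> Inv g"
      proof
        assume wg: "wall z s \<in> Inv g"
        have "\<exists>x\<in>X. wall z s \<in> Inv x"
        proof (rule wall_propagation[OF gc, where P = "\<lambda>_ \<gamma>. \<exists>x\<in>X. \<gamma> \<in> Inv x"])
          fix j s r q \<gamma> c d
          assume a: "j \<in> carrier W" "descent j s" "descent j r" "wall j r \<notin> Inv g"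
            "\<gamma> = comb c (wall j s) d (wall j r)" "0 \<le> c" "0 \<le> d" "\<exists>x\<in>X. \<gamma> \<in> Inv x"
          then obtain x where x: "x \<in> X" "\<gamma> \<in> Inv x" by blast
          have "wall j r \<notin> Inv x" using a(4) x(1) g(1) by (auto simp: U_def)
          then have "wall j s \<in> Inv x"
            using Inv_coclosed[of x "wall j s" "wall j r" \<gamma> c d] x X a
              descentD[OF a(2,1)] descentD[OF a(3,1)] by blast
          then show "\<exists>x\<in>X. wall j s \<in> Inv x" using x by blast
        qed (use base z s wg in blast)+
        then show False using p(2) s by blast
      qed
      ultimately show "U (z \<otimes> s) \<and> Inv g \<subseteq> Inv (z \<otimes> s)" using z d(2) by auto
    qed
    then show ?thesis by simp
  qed
  then show thesis using that g(1) by (auto simp: U_def)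
qed

text \<open>
  The supremum is defined by choice, so its properties depend on the existence of joins.
\<close>

lemma weak_order_sup:
  assumes "weak_bounded W S X"
  defines "j \<equiv> \<Squnion>\<^bsub>weak_order W S\<^esub> X"
  shows "j \<in> carrier W" "\<And>x. x \<in> X \<Longrightarrow> Inv x \<subseteq> Inv j"
    "\<And>p. p \<in> carrier W \<Longrightarrow> (\<And>x. x \<in> X \<Longrightarrow> Inv x \<subseteq> Inv p) \<Longrightarrow> Inv j \<subseteq> Inv p"
proof -
  obtain u where u: "X \<subseteq> carrier W" "u \<in> carrier W" "\<And>x. x \<in> X \<Longrightarrow> Inv x \<subseteq> Inv u"
    using assms(1) by (auto simp: weak_bounded_def weak_order_def cox_prefix_iff)
  have least_iff: "least (weak_order W S) z (Upper (weak_order W S) X) \<longleftrightarrow>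
      z \<in> carrier W \<and> (\<forall>x\<in>X. Inv x \<subseteq> Inv z) \<and>
      (\<forall>p\<in>carrier W. (\<forall>x\<in>X. Inv x \<subseteq> Inv p) \<longrightarrow> Inv z \<subseteq> Inv p)" for z
  proof -
    have "Upper (weak_order W S) X = {p \<in> carrier W. \<forall>x\<in>X. Inv x \<subseteq> Inv p}"
      using u(1) by (auto simp: Upper_def weak_order_def cox_prefix_iff)
    then show ?thesis by (auto simp: least_def weak_order_def cox_prefix_iff)
  qed
  have "\<exists>z. least (weak_order W S) z (Upper (weak_order W S) X)"
    unfolding least_iff using join_exists[OF u] by metis
  then have "least (weak_order W S) j (Upper (weak_order W S) X)"
    unfolding j_def sup_def by (rule someI_ex)
  then show "j \<in> carrier W" "\<And>x. x \<in> X \<Longrightarrow> Inv x \<subseteq> Inv j"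
    "\<And>p. p \<in> carrier W \<Longrightarrow> (\<And>x. x \<in> X \<Longrightarrow> Inv x \<subseteq> Inv p) \<Longrightarrow> Inv j \<subseteq> Inv p"
    unfolding least_iff by blast+
qed

section \<open>Gates form a Garside shadow\<close>

text \<open>
  These are the least elements of the classes of elements \<open>g\<close> with the same cone type of \<open>g\<inverse>\<close>.
  The condition is stated wall by wall, as this is the form in which it propagates.
\<close>

definition gate :: "'a \<Rightarrow> bool" where
  "gate g \<longleftrightarrow> g \<in> carrier W \<and>
     (\<forall>s. descent g s \<longrightarrow> (\<exists>v\<in>carrier W. Inv v \<inter> Inv g = {wall g s}))"

lemma reflect_uminus: "reflect (- u) = reflect u"
  by (intro ext) (simp add: reflect_def comb_apply bil_def sum_negf)

lemma act_conjugate: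
  assumes "w \<in> carrier W" "r \<in> S"
  shows "act (w \<otimes> r \<otimes> inv w) v = reflect (act w (unit r)) v"
proof -
  have "bil (act w (unit r)) v = bil (act w (unit r)) (act w (act (inv w) v))" using assms by simp
  then have "bil (act w (unit r)) v = bil (unit r) (act (inv w) v)" using assms by (simp only: bil_act)
  then show ?thesis using assms S_carrier
    by (simp add: act_mult act_S reflect_def act_comb)
qed

text \<open>
  Let \<open>a\<close> and \<open>b\<close> be the walls of \<open>j\<close> at \<open>s\<close> and \<open>r\<close>, and let \<open>\<gamma> = c a + d b\<close> be inverted by
  \<open>v\<close>. It suffices to find an element with no inversion in the core that inverts \<open>a\<close> but not
  \<open>b\<close>: the first of its prefixes that shares an inversion with \<open>j\<close> then shares exactly \<open>a\<close>. If
  \<open>v\<close> does not invert \<open>b\<close>, then \<open>v\<close> itself is such an element. Otherwise its mirror image in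
  the wall \<open>b\<close> is. The reflection maps the core to itself up to roots that become negative,
  and it turns \<open>\<gamma>\<close> into a root of the plane that is again a nonnegative combination of \<open>a\<close> and
  \<open>b\<close>.
\<close>

lemma gate_propagation_step:
  assumes j: "j \<in> carrier W" and s: "descent j s" and r: "descent j r" and sr: "s \<noteq> r"
    and v: "v \<in> carrier W" "\<gamma> \<in> Inv v" "Inv v \<inter> core j s r = {}"
    and \<gamma>: "\<gamma> = comb c (wall j s) d (wall j r)" "0 \<le> c" "0 \<le> d" "\<gamma> \<noteq> wall j r"
  shows "\<exists>v\<in>carrier W. Inv v \<inter> Inv j = {wall j s}"
proof -
  define a where "a = wall j s"
  define b where "b = wall j r"
  note ds = descentD[OF s j] and dr = descentD[OF r j]
  have ab: "a \<in> roots" "pos a" "b \<in> roots" "pos b" using ds dr by (auto simp: a_def b_def)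
  have ja: "act (inv j) a = - unit s" "act (inv j) b = - unit r"
    using j by (simp_all add: a_def b_def wall_def act_uminus)
  have "\<exists>v2\<in>carrier W. Inv v2 \<inter> core j s r = {} \<and> b \<notin> Inv v2 \<and> a \<in> Inv v2"
  proof (cases "b \<in> Inv v")
    case False
    then have "a \<in> Inv v" using Inv_coclosed[OF v(1) ab False v(2)] \<gamma> by (simp add: a_def b_def)
    then show ?thesis using v False by blast
  next
    case True
    define \<rho> where "\<rho> = j \<otimes> r \<otimes> inv j"
    have \<rho>: "\<rho> \<in> carrier W" using j dr S_carrier by (simp add: \<rho>_def)
    have act_\<rho>: "act \<rho> x = reflect b x" for x
      using act_conjugate[OF j dr(1)] by (simp add: \<rho>_def b_def wall_def reflect_uminus)
    have \<rho>\<rho>: "inv \<rho> = \<rho>" using j dr S_carrier by (simp add: \<rho>_def inv_mult_group m_assoc)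
    \<comment> \<open>\<open>\<rho>\<close> is the reflection in \<open>b\<close>, and \<open>v2\<close> is the mirror image of \<open>v\<close>.\<close>
    define v2 where "v2 = \<rho> \<otimes> v"
    have v2: "v2 \<in> carrier W" using \<rho> v by (simp add: v2_def)
    have inv_v2: "act (inv v2) x = act (inv v) (reflect b x)" for x
      using \<rho> v by (simp add: v2_def inv_mult_group \<rho>\<rho> act_mult act_\<rho>)
    have bb: "bil b b = 1" using ab by simp
    have reflect_b: "reflect b b = - b" by (rule ext) (simp add: reflect_def comb_apply bb)
    have reflect_root: "reflect b x \<in> roots" if "x \<in> roots" for x using act_\<rho> act_root[OF \<rho> that] by simp
    have vb: "neg (act (inv v) b)" using InvD(3)[OF True] .
    have b2: "b \<notin> Inv v2"
    proof
      assume "b \<in> Inv v2"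
      then have "pos (act (inv v) b)" using InvD(3)[of b v2] v by (simp add: inv_v2 reflect_b act_uminus)
      then show False using vb root_not_pos_neg[of "act (inv v) b"] ab v by simp
    qed
    have a2: "a \<in> Inv v2"
    proof -
      have c: "c > 0"
      proof (rule ccontr)
        assume "\<not> c > 0"
        then have "\<gamma> = comb d b 0 b" using \<gamma> by (simp add: comb_def b_def)
        then show False using proportional_roots[of \<gamma> b d] InvD(1)[OF v(2)] ab \<gamma> b_def by blast
      qed
      define \<gamma>' d' where "\<gamma>' = reflect b \<gamma>" and "d' = d - 2 * bil b \<gamma>"
      have \<gamma>': "\<gamma>' = comb c a d' b" unfolding \<gamma>'_def d'_def reflect_def
        by (rule ext) (simp add: comb_apply \<gamma>(1) a_def b_def algebra_simps)
      have r': "\<gamma>' \<in> roots" using reflect_root InvD(1)[OF v(2)] by (simp add: \<gamma>'_def)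
      have e: "act (inv j) \<gamma>' x = - c * unit s x - d' * unit r x" for x
        using j by (simp add: \<gamma>' act_comb ja comb_apply)
      have "act (inv j) \<gamma>' s < 0" using e[of s] c sr by (simp add: unit_apply)
      then have "\<not> pos (act (inv j) \<gamma>')" by (auto simp: pos_def not_le)
      then have "neg (act (inv j) \<gamma>')" using r' j not_pos_iff by simp
      then have "act (inv j) \<gamma>' r \<le> 0" by (simp add: neg_def)
      then have d': "0 \<le> d'" using e[of r] sr by (simp add: unit_apply)
      have "pos \<gamma>'" unfolding \<gamma>' using ab c d' by (intro pos_comb) auto
      moreover have "neg (act (inv v2) \<gamma>')"
        unfolding inv_v2 \<gamma>'_def reflect_involution[OF bb] using InvD(3)[OF v(2)] .
      ultimately have "\<gamma>' \<in> Inv v2" using r' by (intro InvI)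
      then show ?thesis using Inv_coclosed[OF v2 ab b2 _ \<gamma>'] c d' by simp
    qed
    have "Inv v2 \<inter> core j s r = {}"
    proof (rule ccontr)
      assume "Inv v2 \<inter> core j s r \<noteq> {}"
      then obtain \<delta> x where \<delta>: "\<delta> \<in> Inv v2" "\<delta> \<in> core j s r" "\<delta> \<in> Inv j" "x \<notin> {s, r}" "act (inv j) \<delta> x \<noteq> 0"
        by (auto simp: core_def)
      define \<delta>' where "\<delta>' = reflect b \<delta>"
      have r': "\<delta>' \<in> roots" using reflect_root InvD(1)[OF \<delta>(1)] by (simp add: \<delta>'_def)
      have "\<delta>' = act \<rho> \<delta>" by (simp add: \<delta>'_def act_\<rho>)
      then have "act (inv j) \<delta>' = act r (act (inv j) \<delta>)"
        using j dr S_carrier by (simp add: \<rho>_def act_mult)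
      then have x: "act (inv j) \<delta>' x = act (inv j) \<delta> x" using act_S_other[of r x] dr \<delta>(4) by simp
      then have "act (inv j) \<delta>' x < 0" using \<delta>(5) InvD(3)[OF \<delta>(3)] by (auto simp: neg_def less_le)
      then have "\<not> pos (act (inv j) \<delta>')" by (auto simp: pos_def not_le)
      then have nj: "neg (act (inv j) \<delta>')" using r' j not_pos_iff by simp
      have nv: "neg (act (inv v) \<delta>')" using InvD(3)[OF \<delta>(1)] by (simp add: inv_v2 \<delta>'_def)
      show False
      proof (cases "pos \<delta>'")
        case True
        then have "\<delta>' \<in> core j s r" using nj r' x \<delta> by (auto simp: core_def intro!: InvI)
        moreover have "\<delta>' \<in> Inv v" using nv r' True by (intro InvI)
        ultimately show False using v(3) by blast
      next
        case False
        have e: "\<delta>' = comb 1 \<delta> (-2 * bil b \<delta>) b" by (simp add: \<delta>'_def reflect_def)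
        have p: "pos \<delta>" using InvD(2)[OF \<delta>(1)] .
        have k: "bil b \<delta> > 0"
        proof (rule ccontr)
          assume "\<not> bil b \<delta> > 0"
          then have "pos \<delta>'" unfolding e using p ab by (intro pos_comb) auto
          then show False using False by simp
        qed
        have "\<delta> \<notin> Inv v" using v(3) \<delta>(2) by blast
        then have "pos (act (inv v) \<delta>)" using not_in_InvD InvD(1)[OF \<delta>(1)] p v(1) by blast
        moreover have "act (inv v) \<delta>' = comb 1 (act (inv v) \<delta>) (2 * bil b \<delta>) (- act (inv v) b)"
        proof -
          have "act (inv v) \<delta>' = comb 1 (act (inv v) \<delta>) (-2 * bil b \<delta>) (act (inv v) b)"
            unfolding e using v by (simp add: act_comb)
          then show ?thesis by (simp add: comb_def)
        qed
        ultimately have "pos (act (inv v) \<delta>')" using vb k by (auto intro: pos_comb)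
        then show False using nv root_not_pos_neg[of "act (inv v) \<delta>'"] r' v by simp
      qed
    qed
    then show ?thesis using v2 a2 b2 by blast
  qed
  then obtain v2 where v2: "v2 \<in> carrier W" "Inv v2 \<inter> core j s r = {}" "b \<notin> Inv v2" "a \<in> Inv v2" by blast
  have aj: "a \<in> Inv j" using ds by (simp add: a_def)
  then have "Inv v2 \<inter> Inv j \<noteq> {}" using v2 by blast
  then obtain v' \<delta> where v': "v' \<in> carrier W" "Inv v' \<subseteq> Inv v2" "Inv v' \<inter> Inv j = {\<delta>}"
    using truncate[OF v2(1)] by blast
  have \<delta>: "\<delta> \<in> Inv v'" "\<delta> \<in> Inv j" using v' by auto
  then have "\<delta> \<notin> core j s r" using v' v2 by blast
  then have z: "act (inv j) \<delta> x = 0" if "x \<notin> {s, r}" for x using \<delta> that by (auto simp: core_def)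
  define e f where "e = - act (inv j) \<delta> s" and "f = - act (inv j) \<delta> r"
  have ef: "0 \<le> e" "0 \<le> f" using InvD(3)[OF \<delta>(2)] by (auto simp: e_def f_def neg_def)
  have "act (inv j) \<delta> = comb (- e) (unit s) (- f) (unit r)"
    unfolding e_def f_def minus_minus by (rule comb_units[OF sr]) (rule z)
  from arg_cong[OF this, of "act j"] have "\<delta> = comb (- e) (act j (unit s)) (- f) (act j (unit r))"
    using j by (simp add: act_comb)
  also have "\<dots> = comb e a f b" by (rule ext) (simp add: comb_apply a_def b_def wall_def)
  finally have "\<delta> = comb e a f b" .
  then have "a \<in> Inv v'" using Inv_coclosed[OF v'(1) ab _ \<delta>(1)] ef v' v2 by blast
  then have "a \<in> {\<delta>}" using aj unfolding v'(3)[symmetric] by (rule IntI)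
  then have "Inv v' \<inter> Inv j = {wall j s}" using v'(3) by (simp add: a_def)
  then show ?thesis using v'(1) by blast
qed

lemma gate_propagation:
  assumes g: "gate g" and j: "j \<in> carrier W" "Inv g \<subseteq> Inv j" "descent j s" "wall j s \<in> Inv g"
  shows "\<exists>v\<in>carrier W. Inv v \<inter> Inv j = {wall j s}"
proof (rule wall_propagation[where P = "\<lambda>q \<gamma>. \<exists>v\<in>carrier W. Inv v \<inter> Inv q = {\<gamma>}"])
  fix j s r q \<gamma> c d
  assume a: "j \<in> carrier W" "descent j s" "descent j r" "s \<noteq> r"
      "wall j s \<in> Inv g" "wall j r \<notin> Inv g" "q \<in> carrier W" "core j s r \<subseteq> Inv q"
      "\<gamma> \<in> Inv g" "\<gamma> = comb c (wall j s) d (wall j r)" "0 \<le> c" "0 \<le> d"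
      "\<exists>v\<in>carrier W. Inv v \<inter> Inv q = {\<gamma>}"
  then obtain v where v: "v \<in> carrier W" "Inv v \<inter> Inv q = {\<gamma>}" by blast
  have "act (inv j) \<gamma> x = 0" if "x \<notin> {s, r}" for x
    using that a by (simp add: act_comb comb_apply wall_def act_uminus unit_apply)
  then have "\<gamma> \<notin> core j s r" by (auto simp: core_def)
  then have "Inv v \<inter> core j s r = {}" using v a(8) by auto
  then show "\<exists>v\<in>carrier W. Inv v \<inter> Inv j = {wall j s}"
    using gate_propagation_step[of j s r v \<gamma> c d] a v by blast
qed (use g j in \<open>auto simp: gate_def\<close>)

text \<open>
  Each wall of the join \<open>j\<close> is an inversion of some \<open>x \<in> X\<close>, for otherwise a smaller element
  would bound \<open>X\<close>; propagate it from the gate \<open>x\<close> to \<open>j\<close>.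
\<close>

lemma gate_sup:
  assumes X: "\<And>x. x \<in> X \<Longrightarrow> gate x" and b: "weak_bounded W S X"
  shows "gate (\<Squnion>\<^bsub>weak_order W S\<^esub> X)"
proof -
  define j where "j = \<Squnion>\<^bsub>weak_order W S\<^esub> X"
  note sup = weak_order_sup[OF b, folded j_def]
  have "\<exists>v\<in>carrier W. Inv v \<inter> Inv j = {wall j s}" if s: "descent j s" for s
  proof -
    note d = descentD[OF s sup(1)]
    have "\<not> (\<forall>x\<in>X. Inv x \<subseteq> Inv (j \<otimes> s))"
      using sup(3)[of "j \<otimes> s"] sup(1) d S_carrier by auto
    then obtain x where x: "x \<in> X" "\<not> Inv x \<subseteq> Inv (j \<otimes> s)" by blast
    then have "wall j s \<in> Inv x" using sup(2)[OF x(1)] d(2) by auto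
    then show ?thesis using gate_propagation[OF X[OF x(1)] sup(1) sup(2)[OF x(1)] s] by simp
  qed
  then show ?thesis using sup(1) unfolding gate_def j_def by blast
qed

lemma gate_S: assumes s: "s \<in> S" shows "gate s"
  unfolding gate_def
proof (intro conjI allI impI)
  show sc: "s \<in> carrier W" using s S_carrier by simp
  fix r assume r: "descent s r"
  have "wall s r = unit s" using descentD(2)[OF r sc] Inv_unit[OF s] by blast
  then show "\<exists>v\<in>carrier W. Inv v \<inter> Inv s = {wall s r}"
    using sc Inv_unit[OF s] by (intro bexI[of _ s]) auto
qed

text \<open>
  If \<open>g = u b\<close> with lengths adding, then \<open>u\<close> maps the inversions of \<open>b\<close> into those of \<open>g\<close> and
  walls to walls. A witness \<open>v\<close> for a wall of \<open>g\<close> therefore gives the witness \<open>u\<inverse> v\<close> for the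
  wall of \<open>b\<close>.
\<close>

lemma gate_suffix:
  assumes g: "gate g" and bs: "cox_suffix W S b g" shows "gate b"
proof -
  obtain u where u: "u \<in> carrier W" "b \<in> carrier W" "g = u \<otimes> b" "len g = len u + len b"
    using bs by (auto simp: cox_suffix_def reduced_product_def)
  have gc: "g \<in> carrier W" using u by simp
  have ug: "Inv u \<subseteq> Inv g" using Inv_prefix_subset[of u b] u by simp
  have inv_g: "act (inv g) (act u \<delta>) = act (inv b) \<delta>" for \<delta>
    using u by (simp add: inv_mult_group act_mult)
  have pos_u: "pos (act u \<delta>)" if "\<delta> \<in> Inv b" for \<delta>
  proof (rule ccontr)
    note \<delta> = InvD[OF that]
    assume "\<not> pos (act u \<delta>)"
    then have "- act u \<delta> \<in> Inv u" using \<delta> u by (intro InvI) (auto simp: not_pos_iff act_uminus)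
    then have "- act u \<delta> \<in> Inv g" using ug by blast
    then have "pos (act (inv b) \<delta>)" using InvD(3) gc inv_g by (fastforce simp: act_uminus)
    then show False using \<delta> root_not_pos_neg[of "act (inv b) \<delta>"] u by simp
  qed
  have "\<exists>v\<in>carrier W. Inv v \<inter> Inv b = {wall b s}" if s: "descent b s" for s
  proof -
    note d = descentD[OF s u(2)]
    have "g \<otimes> s = u \<otimes> (b \<otimes> s)" using u d S_carrier by (simp add: m_assoc)
    then have "len (g \<otimes> s) \<le> len u + len (b \<otimes> s)" using len_mult_le u d S_carrier by simp
    then have "len (g \<otimes> s) < len g" using u d by simp
    then have "descent g s" using len_descent_iff(1)[OF gc d(1)] d by (simp add: descent_def)
    then obtain v where v: "v \<in> carrier W" "Inv v \<inter> Inv g = {wall g s}" using g by (auto simp: gate_def)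
    have wall: "wall g s = act u (wall b s)" using u by (simp add: wall_def act_mult act_uminus)
    have "Inv (inv u \<otimes> v) \<inter> Inv b = {wall b s}"
    proof -
      have "\<delta> \<in> Inv (inv u \<otimes> v) \<longleftrightarrow> \<delta> = wall b s" if \<delta>: "\<delta> \<in> Inv b" for \<delta>
      proof -
        note D = InvD[OF \<delta>]
        have "neg (act (inv g) (act u \<delta>))" unfolding inv_g by (rule D(3))
        then have ug': "act u \<delta> \<in> Inv g" using D pos_u[OF \<delta>] u by (intro InvI) auto
        have "\<delta> \<in> Inv (inv u \<otimes> v) \<longleftrightarrow> act u \<delta> \<in> Inv v"
          using D pos_u[OF \<delta>] u v by (auto simp: Inv_def inv_mult_group act_mult)
        also have "\<dots> \<longleftrightarrow> act u \<delta> = act u (wall b s)" using v ug' wall by auto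
        also have "\<dots> \<longleftrightarrow> \<delta> = wall b s"
        proof
          assume "act u \<delta> = act u (wall b s)"
          then have "act (inv u) (act u \<delta>) = act (inv u) (act u (wall b s))" by (rule arg_cong)
          then show "\<delta> = wall b s" unfolding act_inv(2)[OF u(1)] .
        qed simp
        finally show ?thesis .
      qed
      then show ?thesis using d(2) by blast
    qed
    then show ?thesis using u v by (intro bexI[of _ "inv u \<otimes> v"]) auto
  qed
  then show ?thesis using u by (auto simp: gate_def)
qed

lemma garside_shadow_gates: "garside_shadow W S {g. gate g}"
  unfolding garside_shadow_def
proof (intro conjI allI impI ballI)
  show "{g. gate g} \<subseteq> carrier W" by (auto simp: gate_def)
  show "S \<subseteq> {g. gate g}" using gate_S by blast
next
  fix X assume "X \<subseteq> {g. gate g} \<and> weak_bounded W S X"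
  then show "\<Squnion>\<^bsub>weak_order W S\<^esub> X \<in> {g. gate g}" using gate_sup[of X] by blast
next
  fix w v assume "w \<in> {g. gate g}" "cox_suffix W S v w"
  then show "v \<in> {g. gate g}" using gate_suffix by simp
qed

definition elementary :: "('a \<Rightarrow> real) set" where
  "elementary = {\<beta>. \<exists>g\<in>carrier W. \<exists>v\<in>carrier W. Inv g \<inter> Inv v = {\<beta>}}"

text \<open>
  Walk from \<open>g\<close> to \<open>h\<close>. If an inversion \<open>\<tau>\<close> of \<open>g\<close> were lost at some \<open>z\<close>, then \<open>\<tau>\<close> would be a
  wall of \<open>z\<close> and no inversion of \<open>h\<close>, and propagation would provide \<open>v\<close> with
  \<open>Inv v \<inter> Inv z = {\<tau>}\<close>. Cut \<open>v\<close> down to its first inversion \<open>\<delta>\<close> in \<open>Inv g \<union> Inv h\<close>. As \<open>g\<close>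
  and \<open>h\<close> have the same type, \<open>\<delta>\<close> is an inversion of both. So it is an inversion of \<open>z\<close>, hence
  equal to \<open>\<tau>\<close>, although \<open>\<tau>\<close> is no inversion of \<open>h\<close>.
\<close>

lemma gate_minimal:
  assumes g: "gate g" and h: "h \<in> carrier W"
    and type: "\<And>v. v \<in> carrier W \<Longrightarrow> Inv v \<inter> Inv g = {} \<longleftrightarrow> Inv v \<inter> Inv h = {}"
  shows "Inv g \<subseteq> Inv h"
proof -
  have gc: "g \<in> carrier W" using g by (simp add: gate_def)
  let ?C = "\<lambda>z. Inv g \<subseteq> Inv z \<and> Inv z \<subseteq> Inv g \<union> Inv h"
  have "?C h"
  proof (rule toward_induct[OF gc h, where C = ?C])
    fix z s assume "z \<in> carrier W" "?C z" "s \<in> S" "pos (act z (unit s))" "act z (unit s) \<in> Inv h"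
    then show "?C (z \<otimes> s)" using Inv_ascent(1)[of z s] by auto
  next
    fix z s assume z: "z \<in> carrier W" "?C z" and s: "descent z s" "wall z s \<notin> Inv h"
    note d = descentD[OF s(1) z(1)]
    have "wall z s \<notin> Inv g"
    proof
      assume wg: "wall z s \<in> Inv g"
      then obtain v where v: "v \<in> carrier W" "Inv v \<inter> Inv z = {wall z s}"
        using gate_propagation[OF g z(1) _ s(1) wg] z by blast
      then have n: "Inv v \<inter> (Inv g \<union> Inv h) \<noteq> {}" using wg by blast
      obtain v' \<delta> where v': "v' \<in> carrier W" "Inv v' \<subseteq> Inv v" "Inv v' \<inter> (Inv g \<union> Inv h) = {\<delta>}"
        using truncate[OF v(1) n] .
      have \<delta>: "\<delta> \<in> Inv v'" "\<delta> \<in> Inv g \<union> Inv h" using v'(3) by auto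
      have "Inv v' \<inter> Inv g \<subseteq> {\<delta>}" "Inv v' \<inter> Inv h \<subseteq> {\<delta>}" using v'(3) by auto
      moreover have "Inv v' \<inter> Inv g \<noteq> {}" "Inv v' \<inter> Inv h \<noteq> {}" using \<delta> type[OF v'(1)] by auto
      ultimately have "\<delta> \<in> Inv g" "\<delta> \<in> Inv h" by auto
      then have "\<delta> \<in> Inv v \<inter> Inv z" using z(2) v'(2) \<delta>(1) by auto
      then have "\<delta> = wall z s" using v(2) by auto
      then show False using \<open>\<delta> \<in> Inv h\<close> s(2) by simp
    qed
    then show "?C (z \<otimes> s)" using z d(2) by auto
  qed simp
  then show ?thesis by simp
qed

text \<open>
  Whether \<open>v\<close> and \<open>g\<close> share an inversion can be tested on elementary roots, by \<open>truncate\<close>. So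
  gates with the same elementary inversions have the same type, and each lies below the other.
\<close>

lemma finite_gates: assumes "finite elementary" shows "finite {g. gate g}"
proof (rule finite_imageD)
  show "finite ((\<lambda>g. Inv g \<inter> elementary) ` {g. gate g})"
    by (rule finite_subset[of _ "Pow elementary"]) (use assms in auto)
  have meets: "Inv v \<inter> Inv h \<noteq> {}" if e: "Inv g \<inter> elementary = Inv h \<inter> elementary"
    and c: "g \<in> carrier W" "v \<in> carrier W" and n: "Inv v \<inter> Inv g \<noteq> {}" for g h v
  proof -
    obtain v' \<delta> where v': "v' \<in> carrier W" "Inv v' \<subseteq> Inv v" "Inv v' \<inter> Inv g = {\<delta>}"
      using truncate[OF c(2) n] .
    have "\<delta> \<in> elementary" unfolding elementary_def mem_Collect_eq
      using v'(3) by (intro bexI[OF _ v'(1)] bexI[OF _ c(1)])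
    then have "\<delta> \<in> Inv h" "\<delta> \<in> Inv v" using v'(2,3) e by auto
    then show ?thesis by blast
  qed
  show "inj_on (\<lambda>g. Inv g \<inter> elementary) {g. gate g}"
  proof (rule inj_onI, simp)
    fix g h assume g: "gate g" and h: "gate h" and e: "Inv g \<inter> elementary = Inv h \<inter> elementary"
    have c: "g \<in> carrier W" "h \<in> carrier W" using g h by (auto simp: gate_def)
    have "Inv v \<inter> Inv g = {} \<longleftrightarrow> Inv v \<inter> Inv h = {}" if "v \<in> carrier W" for v
      using meets[OF e c(1) that] meets[OF e[symmetric] c(2) that] by blast
    then have "Inv g \<subseteq> Inv h" "Inv h \<subseteq> Inv g"
      using gate_minimal[OF g c(2)] gate_minimal[OF h c(1)] by simp_all
    then show "g = h" using Inv_eq_imp_eq c by blast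
  qed
qed

section \<open>Finiteness of the inner products of intersecting roots\<close>

lemma eq_one_of_pos:
  assumes "w \<in> carrier W" "\<And>s. s \<in> S \<Longrightarrow> pos (act w (unit s))" shows "w = \<one>"
proof (rule ccontr)
  assume "w \<noteq> \<one>"
  then obtain s where s: "descent w s" using exists_descent assms(1) by blast
  then have "s \<in> S" "neg (act w (unit s))" by (auto simp: descent_def)
  then show False using assms root_not_pos_neg[of "act w (unit s)"] by simp
qed

lemma reflection_exists:
  assumes "\<gamma> \<in> roots" obtains \<rho> where "\<rho> \<in> carrier W" "\<And>v. act \<rho> v = reflect \<gamma> v"
proof -
  obtain w s where w: "w \<in> carrier W" "s \<in> S" "\<gamma> = act w (unit s)" using assms by (auto simp: roots_def)
  show thesis
    by (rule that[of "w \<otimes> s \<otimes> inv w"]) (use w S_carrier act_conjugate in auto)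
qed

lemma reflect_root_self: "\<beta> \<in> roots \<Longrightarrow> reflect \<beta> \<beta> = - \<beta>"
  by (rule ext) (simp add: reflect_def comb_apply)

lemma abs_bil_le:
  assumes "\<And>q. q \<in> S \<Longrightarrow> \<bar>u q\<bar> \<le> A" "\<And>q. q \<in> S \<Longrightarrow> \<bar>v q\<bar> \<le> B" "0 \<le> A"
  shows "\<bar>bil u v\<bar> \<le> (real (card S))\<^sup>2 * (A * B)"
proof -
  have "\<bar>bil u v\<bar> \<le> (\<Sum>s\<in>S. \<Sum>t\<in>S. \<bar>u s * v t * entry s t\<bar>)"
    unfolding bil_def by (rule order_trans[OF sum_abs]) (intro sum_mono sum_abs)
  also have "\<dots> \<le> (\<Sum>s\<in>S. \<Sum>t\<in>S. A * B)"
  proof (intro sum_mono)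
    fix s t assume st: "s \<in> S" "t \<in> S"
    have "\<bar>u s * v t * entry s t\<bar> \<le> \<bar>u s\<bar> * \<bar>v t\<bar>"
      using abs_entry_le[of s t] by (simp add: abs_mult mult_left_le)
    also have "\<dots> \<le> A * B" using assms st by (intro mult_mono) auto
    finally show "\<bar>u s * v t * entry s t\<bar> \<le> A * B" .
  qed
  finally show ?thesis by (simp add: power2_eq_square)
qed

text \<open>
  The group acts discretely: if \<open>\<gamma>\<close> and \<open>\<gamma>'\<close> are close, the product of their reflections moves
  every simple root so little that the coordinate \<open>1\<close> stays positive. It then has no descents,
  so it is the identity and the two reflections agree.
\<close>

lemma close_roots_eq:
  assumes r: "\<gamma> \<in> roots" "\<gamma>' \<in> roots" "pos \<gamma>" "pos \<gamma>'"
    and M: "\<And>q. q \<in> S \<Longrightarrow> \<bar>\<gamma> q\<bar> \<le> M" "\<And>q. q \<in> S \<Longrightarrow> \<bar>\<gamma>' q\<bar> \<le> M" "0 \<le> M"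
    and \<epsilon>: "\<And>q. q \<in> S \<Longrightarrow> \<bar>\<gamma> q - \<gamma>' q\<bar> \<le> \<epsilon>" "0 \<le> \<epsilon>"
    and small: "N = (real (card S))\<^sup>2" "4 * N * M * \<epsilon> * (1 + 2 * N * M * M) < 1"
  shows "\<gamma> = \<gamma>'"
proof -
  obtain \<rho> where \<rho>: "\<rho> \<in> carrier W" "\<And>v. act \<rho> v = reflect \<gamma> v" using reflection_exists[OF r(1)] by blast
  obtain \<rho>' where \<rho>': "\<rho>' \<in> carrier W" "\<And>v. act \<rho>' v = reflect \<gamma>' v" using reflection_exists[OF r(2)] by blast
  define D where "D = 4 * N * M * \<epsilon>"
  have N: "0 \<le> N" by (simp add: small(1))
  have D0: "0 \<le> D" using M \<epsilon> N by (simp add: D_def)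
  have p: "pos (act (\<rho> \<otimes> \<rho>') (unit s))" if s: "s \<in> S" for s
  proof -
    define d where "d = comb 1 (reflect \<gamma>' (unit s)) (-1) (reflect \<gamma> (unit s))"
    have u1: "\<bar>unit s q\<bar> \<le> 1" for q by (simp add: unit_apply)
    have dq: "\<bar>d q\<bar> \<le> D" if q: "q \<in> S" for q
    proof -
      define e where "e = comb 1 \<gamma> (-1) \<gamma>'"
      have be: "\<bar>bil e (unit s)\<bar> \<le> N * (\<epsilon> * 1)"
        unfolding small(1) by (rule abs_bil_le) (use \<epsilon> u1 in \<open>auto simp: e_def comb_apply\<close>)
      have bg: "\<bar>bil \<gamma>' (unit s)\<bar> \<le> N * (M * 1)"
        unfolding small(1) by (rule abs_bil_le) (use M u1 in auto)
      have "bil \<gamma> (unit s) = bil e (unit s) + bil \<gamma>' (unit s)" by (simp add: e_def bil_comb_left)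
      then have "d q = 2 * (bil e (unit s) * \<gamma> q) + 2 * (bil \<gamma>' (unit s) * (\<gamma> q - \<gamma>' q))"
        by (simp add: d_def reflect_def comb_apply algebra_simps)
      then have "\<bar>d q\<bar> \<le> 2 * (\<bar>bil e (unit s)\<bar> * \<bar>\<gamma> q\<bar>) + 2 * (\<bar>bil \<gamma>' (unit s)\<bar> * \<bar>\<gamma> q - \<gamma>' q\<bar>)"
        by (simp add: abs_mult[symmetric])
      also have "\<dots> \<le> 2 * ((N * (\<epsilon> * 1)) * M) + 2 * ((N * (M * 1)) * \<epsilon>)"
        using be bg M q \<epsilon> N by (intro add_mono mult_left_mono mult_mono) auto
      finally show ?thesis by (simp add: D_def algebra_simps)
    qed
    have bd: "\<bar>bil \<gamma> d\<bar> \<le> N * (M * D)"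
      unfolding small(1) by (rule abs_bil_le) (use M dq in auto)
    have "reflect \<gamma> d s = d s - 2 * (bil \<gamma> d * \<gamma> s)" by (simp add: reflect_def comb_apply)
    then have "\<bar>reflect \<gamma> d s\<bar> \<le> \<bar>d s\<bar> + 2 * (\<bar>bil \<gamma> d\<bar> * \<bar>\<gamma> s\<bar>)"
      by (simp add: abs_mult[symmetric])
    also have "\<dots> \<le> D + 2 * ((N * (M * D)) * M)"
      using bd dq[OF s] M s D0 N by (intro add_mono mult_left_mono mult_mono) auto
    also have "\<dots> = D * (1 + 2 * N * M * M)" by (simp add: algebra_simps)
    also have "\<dots> < 1" using small(2) by (simp add: D_def)
    finally have lt: "\<bar>reflect \<gamma> d s\<bar> < 1" .
    have "reflect \<gamma>' (unit s) = comb 1 (reflect \<gamma> (unit s)) 1 d" by (rule ext) (simp add: d_def comb_apply)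
    then have "act (\<rho> \<otimes> \<rho>') (unit s) = comb 1 (reflect \<gamma> (reflect \<gamma> (unit s))) 1 (reflect \<gamma> d)"
      using \<rho> \<rho>' by (simp add: act_mult reflect_comb)
    then have "act (\<rho> \<otimes> \<rho>') (unit s) s = 1 + reflect \<gamma> d s"
      using reflect_involution[OF root_norm[OF r(1)], of "unit s"] by (simp add: comb_apply)
    then have "act (\<rho> \<otimes> \<rho>') (unit s) s > 0" using lt by linarith
    then have "\<not> neg (act (\<rho> \<otimes> \<rho>') (unit s))" by (auto simp: neg_def not_le)
    then show ?thesis using \<rho> \<rho>' s not_neg_iff by simp
  qed
  have "\<rho> \<otimes> \<rho>' = \<one>" by (rule eq_one_of_pos) (use p \<rho> \<rho>' in auto)
  then have "act (\<rho> \<otimes> \<rho>') \<gamma>' = \<gamma>'" by simp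
  then have "act \<rho> (- \<gamma>') = \<gamma>'" using \<rho>(1) \<rho>' r by (simp add: act_mult reflect_root_self)
  then have "- act \<rho> \<gamma>' = \<gamma>'" using \<rho>(1) by (simp add: act_uminus)
  then have "- reflect \<gamma> \<gamma>' q = \<gamma>' q" for q unfolding \<rho>(2) by (metis uminus_apply)
  then have q: "\<gamma>' q = bil \<gamma> \<gamma>' * \<gamma> q" for q
    by (auto simp: reflect_def comb_apply dest!: meta_spec[of _ q])
  then have e: "\<gamma>' = comb (bil \<gamma> \<gamma>') \<gamma> 0 \<gamma>" by (intro ext) (simp add: comb_apply)
  have "0 \<le> bil \<gamma> \<gamma>'"
  proof (rule ccontr)
    assume "\<not> 0 \<le> bil \<gamma> \<gamma>'"
    then have "neg \<gamma>'" using q r by (simp add: neg_def pos_def mult_nonpos_nonneg)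
    then show False using r root_not_pos_neg by blast
  qed
  then show ?thesis using proportional_roots[OF r(2,1) e] by simp
qed

text \<open>
  Sort the roots into boxes of side \<open>\<epsilon>\<close>, each of which contains at most one root.
\<close>

lemma finite_bounded_pos_roots: "finite {\<beta> \<in> roots. pos \<beta> \<and> (\<forall>q\<in>S. \<bar>\<beta> q\<bar> \<le> M)}"
proof -
  \<comment> \<open>The constants make the bound of \<open>close_roots_eq\<close> equal to \<open>C / (1 + C) < 1\<close>.\<close>
  define K where "K = max 1 M"
  define N where "N = (real (card S))\<^sup>2"
  define C where "C = 4 * N * K * (1 + 2 * N * K * K)"
  have K: "1 \<le> K" "M \<le> K" by (auto simp: K_def)
  have C: "0 \<le> C" using K by (simp add: C_def N_def)
  define \<epsilon> where "\<epsilon> = 1 / (1 + C)"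
  have \<epsilon>: "\<epsilon> > 0" using C by (simp add: \<epsilon>_def)
  have C\<epsilon>: "4 * N * K * \<epsilon> * (1 + 2 * N * K * K) < 1"
  proof -
    have "4 * N * K * \<epsilon> * (1 + 2 * N * K * K) = C * \<epsilon>" by (simp add: C_def)
    also have "\<dots> < 1" using C by (simp add: \<epsilon>_def)
    finally show ?thesis .
  qed
  let ?A = "{\<beta> \<in> roots. pos \<beta> \<and> (\<forall>q\<in>S. \<bar>\<beta> q\<bar> \<le> M)}"
  define f where "f = (\<lambda>\<beta>. \<lambda>q\<in>S. \<lfloor>\<beta> q / \<epsilon>\<rfloor>)"
  show ?thesis
  proof (rule finite_imageD)
    have "f ` ?A \<subseteq> PiE S (\<lambda>_. {\<lfloor>- K / \<epsilon>\<rfloor>..\<lfloor>K / \<epsilon>\<rfloor>})"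
    proof (intro image_subsetI PiE_I)
      fix \<beta> q assume b: "\<beta> \<in> ?A" and q: "q \<in> S"
      then have "\<bar>\<beta> q\<bar> \<le> M" by blast
      then have "- K \<le> \<beta> q" "\<beta> q \<le> K" using K by linarith+
      then have "- K / \<epsilon> \<le> \<beta> q / \<epsilon>" "\<beta> q / \<epsilon> \<le> K / \<epsilon>"
        using \<epsilon> by (intro divide_right_mono; simp)+
      then show "f \<beta> q \<in> {\<lfloor>- K / \<epsilon>\<rfloor>..\<lfloor>K / \<epsilon>\<rfloor>}" using q by (auto simp: f_def intro: floor_mono)
    qed (simp add: f_def)
    then show "finite (f ` ?A)" by (rule finite_subset) (simp add: finite_PiE)
    show "inj_on f ?A"
    proof (rule inj_onI)
      fix \<beta> \<gamma> assume b: "\<beta> \<in> ?A" and g: "\<gamma> \<in> ?A" and e: "f \<beta> = f \<gamma>"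
      have "\<bar>\<beta> q - \<gamma> q\<bar> \<le> \<epsilon>" if q: "q \<in> S" for q
      proof -
        have "\<lfloor>\<beta> q / \<epsilon>\<rfloor> = \<lfloor>\<gamma> q / \<epsilon>\<rfloor>" using fun_cong[OF e, of q] q by (simp add: f_def)
        then have "\<bar>\<beta> q / \<epsilon> - \<gamma> q / \<epsilon>\<bar> \<le> 1" by linarith
        then have "\<bar>\<beta> q - \<gamma> q\<bar> / \<epsilon> \<le> 1" using \<epsilon> by (simp add: diff_divide_distrib[symmetric])
        then show ?thesis using \<epsilon> by (simp add: divide_le_eq)
      qed
      then show "\<beta> = \<gamma>"
        using close_roots_eq[of \<beta> \<gamma> K \<epsilon> N] b g K \<epsilon> C\<epsilon> by (force simp: N_def)
    qed
  qed
qed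

lemma finite_of_pos:
  assumes "finite {\<beta> \<in> roots. pos \<beta> \<and> P \<beta>}" "\<And>\<beta>. \<beta> \<in> roots \<Longrightarrow> P \<beta> \<Longrightarrow> P (- \<beta>)"
  shows "finite {\<beta> \<in> roots. P \<beta>}"
proof (rule finite_subset)
  let ?A = "{\<beta> \<in> roots. pos \<beta> \<and> P \<beta>}"
  show "finite (?A \<union> uminus ` ?A)" using assms(1) by simp
  show "{\<beta> \<in> roots. P \<beta>} \<subseteq> ?A \<union> uminus ` ?A"
  proof
    fix \<beta> assume "\<beta> \<in> {\<beta> \<in> roots. P \<beta>}"
    then have b: "\<beta> \<in> roots" "P \<beta>" by auto
    show "\<beta> \<in> ?A \<union> uminus ` ?A"
    proof (cases "pos \<beta>")
      case False
      then have "- \<beta> \<in> ?A" using b assms(2) not_pos_iff by simp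
      then have "- (- \<beta>) \<in> uminus ` ?A" by (rule imageI)
      moreover have "- (- \<beta>) = \<beta>" by (rule ext) simp
      ultimately show ?thesis by simp
    qed (use b in simp)
  qed
qed

lemma finite_bounded_roots: "finite {\<beta> \<in> roots. \<forall>q\<in>S. \<bar>\<beta> q\<bar> \<le> M}"
  by (rule finite_of_pos[OF finite_bounded_pos_roots]) simp

text \<open>
  The left-hand side of the equation is \<open>bil p p + 2 bil u p\<close> for a vector \<open>p = x \<alpha> + y \<beta>\<close> of
  a positive definite plane with \<open>c = bil \<alpha> \<beta>\<close>; that it vanishes means that \<open>u\<close> and \<open>u + p\<close>
  have the same norm, which bounds \<open>p\<close>.
\<close>

lemma quadratic_bound:
  fixes x y c T A B :: real
  assumes c: "\<bar>c\<bar> < 1" and T: "\<bar>A\<bar> \<le> T" "\<bar>B\<bar> \<le> T"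
    and e: "x * x + 2 * c * x * y + y * y + 2 * (x * A + y * B) = 0"
  shows "\<bar>x\<bar> \<le> 4 * T / (1 - \<bar>c\<bar>)" "\<bar>y\<bar> \<le> 4 * T / (1 - \<bar>c\<bar>)"
proof -
  define z where "z = max \<bar>x\<bar> \<bar>y\<bar>"
  have z: "\<bar>x\<bar> \<le> z" "\<bar>y\<bar> \<le> z" "0 \<le> z" "z = \<bar>x\<bar> \<or> z = \<bar>y\<bar>" by (auto simp: z_def)
  have "z * z \<le> x * x + y * y" using z(4) by auto
  moreover have "2 * \<bar>x * y\<bar> \<le> x * x + y * y"
    using zero_le_power2[of "\<bar>x\<bar> - \<bar>y\<bar>"] by (simp add: power2_eq_square algebra_simps abs_mult)
  then have "\<bar>c\<bar> * (2 * \<bar>x * y\<bar>) \<le> \<bar>c\<bar> * (x * x + y * y)" by (rule mult_left_mono) simp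
  moreover have "- (2 * c * x * y) \<le> \<bar>c\<bar> * (2 * \<bar>x * y\<bar>)"
    using abs_ge_minus_self[of "2 * c * x * y"] by (simp add: abs_mult)
  moreover have "- (x * A + y * B) \<le> z * T + z * T"
  proof -
    have "\<bar>x * A\<bar> \<le> z * T" "\<bar>y * B\<bar> \<le> z * T"
      unfolding abs_mult using z T by (auto intro!: mult_mono)
    then show ?thesis by linarith
  qed
  moreover have "(1 - \<bar>c\<bar>) * (z * z) \<le> (1 - \<bar>c\<bar>) * (x * x + y * y)"
    using c \<open>z * z \<le> x * x + y * y\<close> by (intro mult_left_mono) auto
  ultimately have "(1 - \<bar>c\<bar>) * (z * z) \<le> 4 * T * z"
    using e by (simp add: algebra_simps)
  then have *: "z * ((1 - \<bar>c\<bar>) * z) \<le> z * (4 * T)" by (simp add: algebra_simps)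
  have "z \<le> 4 * T / (1 - \<bar>c\<bar>)"
  proof (cases "z = 0")
    case True
    then show ?thesis using T c by (auto intro!: divide_nonneg_nonneg)
  next
    case False
    then have "(1 - \<bar>c\<bar>) * z \<le> 4 * T" using * z(3) by (simp add: mult_le_cancel_left_pos)
    then show ?thesis using c by (simp add: pos_le_divide_eq mult.commute)
  qed
  then show "\<bar>x\<bar> \<le> 4 * T / (1 - \<bar>c\<bar>)" "\<bar>y\<bar> \<le> 4 * T / (1 - \<bar>c\<bar>)" using z by linarith+
qed

text \<open>
  If the plane is nondegenerate, these are the elements that fix its orthogonal complement
  pointwise. The present form makes closure under the reflections in \<open>\<alpha>\<close> and \<open>\<beta>\<close> immediate.
\<close>

definition plane_fixer :: "('a \<Rightarrow> real) \<Rightarrow> ('a \<Rightarrow> real) \<Rightarrow> 'a set" where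
  "plane_fixer \<alpha> \<beta> = {k \<in> carrier W. \<forall>v. \<exists>x y. act k v = comb 1 v 1 (comb x \<alpha> y \<beta>)}"

text \<open>
  Such elements move each simple root by a vector of the plane and preserve its norm. On a
  positive definite plane this leaves a bounded set of roots as possible images, and bounded
  sets of roots are finite.
\<close>

lemma finite_plane_fixer:
  assumes r: "\<alpha> \<in> roots" "\<beta> \<in> roots" and c: "\<bar>bil \<alpha> \<beta>\<bar> < 1"
  shows "finite (plane_fixer \<alpha> \<beta>)"
proof -
  define T where "T = (\<Sum>s\<in>S. \<bar>bil (unit s) \<alpha>\<bar> + \<bar>bil (unit s) \<beta>\<bar>)"
  define L where "L = (\<Sum>q\<in>S. \<bar>\<alpha> q\<bar> + \<bar>\<beta> q\<bar>)"
  define Z where "Z = 4 * T / (1 - \<bar>bil \<alpha> \<beta>\<bar>)"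
  have Tge: "\<bar>bil (unit s) \<alpha>\<bar> + \<bar>bil (unit s) \<beta>\<bar> \<le> T" if "s \<in> S" for s
    unfolding T_def by (rule member_le_sum) (use that in auto)
  have Lge: "\<bar>\<alpha> q\<bar> + \<bar>\<beta> q\<bar> \<le> L" if "q \<in> S" for q
    unfolding L_def by (rule member_le_sum) (use that in auto)
  have L0: "0 \<le> L" and T0: "0 \<le> T" by (auto simp: L_def T_def intro!: sum_nonneg)
  then have Z0: "0 \<le> Z" using c by (simp add: Z_def)
  define R where "R = {\<gamma> \<in> roots. \<forall>q\<in>S. \<bar>\<gamma> q\<bar> \<le> 1 + Z * L}"
  have inR: "act k (unit s) \<in> R" if k: "k \<in> plane_fixer \<alpha> \<beta>" and s: "s \<in> S" for k s
  proof -
    have kc: "k \<in> carrier W" using k by (simp add: plane_fixer_def)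
    obtain x y where xy: "act k (unit s) = comb 1 (unit s) 1 (comb x \<alpha> y \<beta>)"
      using k unfolding plane_fixer_def by blast
    define A B where "A = bil (unit s) \<alpha>" and "B = bil (unit s) \<beta>"
    have "1 = bil (act k (unit s)) (act k (unit s))" using kc s by simp
    then have "x * x + 2 * bil \<alpha> \<beta> * x * y + y * y + 2 * (x * A + y * B) = 0"
      unfolding xy using r s bil_sym[of \<beta> \<alpha>] bil_sym[of \<alpha> "unit s"] bil_sym[of \<beta> "unit s"]
      by (simp add: bil_comb_left bil_comb_right A_def B_def algebra_simps)
    moreover have "\<bar>A\<bar> \<le> T" "\<bar>B\<bar> \<le> T" using Tge[OF s] by (auto simp: A_def B_def)
    ultimately have Z: "\<bar>x\<bar> \<le> Z" "\<bar>y\<bar> \<le> Z" using quadratic_bound[OF c] unfolding Z_def by blast+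
    have "\<bar>act k (unit s) q\<bar> \<le> 1 + Z * L" if q: "q \<in> S" for q
    proof -
      have "\<bar>act k (unit s) q\<bar> \<le> \<bar>unit s q\<bar> + (\<bar>x * \<alpha> q\<bar> + \<bar>y * \<beta> q\<bar>)"
        unfolding xy comb_apply mult_1 by linarith
      also have "\<dots> \<le> 1 + (Z * \<bar>\<alpha> q\<bar> + Z * \<bar>\<beta> q\<bar>)"
        unfolding abs_mult using Z by (intro add_mono mult_right_mono) (auto simp: unit_apply)
      also have "\<dots> \<le> 1 + Z * L"
        using mult_left_mono[OF Lge[OF q] Z0] by (simp add: algebra_simps)
      finally show ?thesis .
    qed
    then show ?thesis using kc s by (simp add: R_def)
  qed
  let ?f = "\<lambda>k. \<lambda>s\<in>S. act k (unit s)"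
  show ?thesis
  proof (rule finite_imageD)
    have "?f ` plane_fixer \<alpha> \<beta> \<subseteq> PiE S (\<lambda>_. R)" using inR by auto
    moreover have "finite R" unfolding R_def by (rule finite_bounded_roots)
    ultimately show "finite (?f ` plane_fixer \<alpha> \<beta>)" by (simp add: finite_PiE finite_subset)
    show "inj_on ?f (plane_fixer \<alpha> \<beta>)"
    proof (rule inj_onI)
      fix k l assume "k \<in> plane_fixer \<alpha> \<beta>" "l \<in> plane_fixer \<alpha> \<beta>" and e: "?f k = ?f l"
      then have kl: "k \<in> carrier W" "l \<in> carrier W" by (auto simp: plane_fixer_def)
      have "act (inv l \<otimes> k) (unit s) = unit s" if "s \<in> S" for s
        using fun_cong[OF e, of s] that kl by (simp add: act_mult)
      then have "inv l \<otimes> k = \<one>" using kl by (intro eq_one_of_pos) auto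
      then have "l \<otimes> (inv l \<otimes> k) = l" using kl by simp
      then show "k = l" using kl by (simp add: m_assoc[symmetric])
    qed
  qed
qed

definition functional :: "(('a \<Rightarrow> real) \<Rightarrow> real) \<Rightarrow> bool" where
  "functional f \<longleftrightarrow> (\<forall>x u y v. f (comb x u y v) = x * f u + y * f v)"

lemma functionalD: "functional f \<Longrightarrow> f (comb x u y v) = x * f u + y * f v"
  by (simp add: functional_def)

lemma functional_expand:
  assumes "functional f" "finite A" "\<And>q. q \<notin> A \<Longrightarrow> v q = 0"
  shows "f v = (\<Sum>s\<in>A. v s * f (unit s))"
  using assms(2,3)
proof (induction A arbitrary: v)
  case empty
  then have "v = comb 0 v 0 v" by (auto simp: comb_def)
  then have "f v = f (comb 0 v 0 v)" by simp
  then show ?case using functionalD[OF assms(1), of 0 v 0 v] by simp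
next
  case (insert a A)
  define v' where "v' = comb 1 v (- v a) (unit a)"
  have "f v' = (\<Sum>s\<in>A. v' s * f (unit s))"
    by (rule insert.IH) (use insert.prems in \<open>auto simp: v'_def comb_apply unit_apply\<close>)
  also have "\<dots> = (\<Sum>s\<in>A. v s * f (unit s))"
    by (rule sum.cong) (use insert.hyps in \<open>auto simp: v'_def comb_apply unit_apply\<close>)
  finally show ?case using functionalD[OF assms(1), of 1 v "- v a" "unit a"] insert.hyps
    by (simp add: v'_def)
qed

lemma functional_uminus: "functional f \<Longrightarrow> f (- v) = - f v"
proof -
  assume f: "functional f"
  have "- v = comb (-1) v 0 v" by (rule ext) (simp add: comb_apply)
  then show ?thesis using functionalD[OF f, of "-1" v 0 v] by simp
qed

text \<open>
  If \<open>f\<close> is negative on a simple root, reflect in that root: this permutes the other positive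
  roots and so lowers the number of positive roots on which \<open>f\<close> is not positive.
\<close>

lemma dominant_translate:
  assumes "functional f" "finite {\<gamma> \<in> roots. pos \<gamma> \<and> f \<gamma> \<le> 0}"
  obtains w where "w \<in> carrier W" "\<And>s. s \<in> S \<Longrightarrow> 0 \<le> f (act w (unit s))"
    "finite {\<gamma> \<in> roots. pos \<gamma> \<and> f (act w \<gamma>) \<le> 0}"
proof -
  have "\<exists>w\<in>carrier W. (\<forall>s\<in>S. 0 \<le> f (act w (unit s))) \<and>
      finite {\<gamma> \<in> roots. pos \<gamma> \<and> f (act w \<gamma>) \<le> 0}"
    using assms
  proof (induction "card {\<gamma> \<in> roots. pos \<gamma> \<and> f \<gamma> \<le> 0}" arbitrary: f rule: less_induct)
    case less
    let ?Z = "\<lambda>f. {\<gamma> \<in> roots. pos \<gamma> \<and> f \<gamma> \<le> 0}"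
    show ?case
    proof (cases "\<forall>s\<in>S. 0 \<le> f (unit s)")
      case True
      then show ?thesis using less.prems by (intro bexI[of _ "\<one>"]) auto
    next
      case False
      then obtain s where s: "s \<in> S" "f (unit s) < 0" by (auto simp: not_le)
      have sc: "s \<in> carrier W" using s S_carrier by simp
      define f' where "f' = (\<lambda>v. f (act s v))"
      have lin: "functional f'" using less.prems(1) sc by (simp add: functional_def f'_def act_comb)
      have ss: "act s (act s v) = v" for v using act_inv(1)[OF sc, of v] s by simp
      have us: "unit s \<in> ?Z f" using s by simp
      have sub: "?Z f' \<subseteq> act s ` (?Z f - {unit s})"
      proof
        fix \<gamma> assume "\<gamma> \<in> ?Z f'"
        then have g: "\<gamma> \<in> roots" "pos \<gamma>" "f (act s \<gamma>) \<le> 0" by (auto simp: f'_def)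
        have "\<gamma> \<noteq> unit s"
          using g(3) s functional_uminus[OF less.prems(1), of "unit s"] by (auto simp: act_S reflect_unit_self)
        then have "pos (act s \<gamma>)" using simple_neg[OF g(1,2) s(1)] not_neg_iff[of "act s \<gamma>"] g(1) sc by auto
        moreover have "act s \<gamma> \<noteq> unit s"
        proof
          assume "act s \<gamma> = unit s"
          then have "\<gamma> = act s (unit s)" using ss[of \<gamma>] by simp
          then have "neg \<gamma>" using s by (simp add: act_S reflect_unit_self)
          then show False using g root_not_pos_neg by blast
        qed
        ultimately have "act s \<gamma> \<in> ?Z f - {unit s}" using g sc by simp
        then have "act s (act s \<gamma>) \<in> act s ` (?Z f - {unit s})" by (rule imageI)
        then show "\<gamma> \<in> act s ` (?Z f - {unit s})" by (simp only: ss)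
      qed
      have fin: "finite (?Z f')" by (rule finite_subset[OF sub]) (use less.prems(2) in simp)
      have "card (?Z f') \<le> card (act s ` (?Z f - {unit s}))"
        by (rule card_mono[OF _ sub]) (use less.prems(2) in simp)
      also have "\<dots> \<le> card (?Z f - {unit s})" by (rule card_image_le) (use less.prems(2) in simp)
      also have "\<dots> < card (?Z f)" by (rule card_Diff1_less[OF less.prems(2) us])
      finally obtain w where w: "w \<in> carrier W" "\<forall>r\<in>S. 0 \<le> f' (act w (unit r))"
          "finite {\<gamma> \<in> roots. pos \<gamma> \<and> f' (act w \<gamma>) \<le> 0}"
        using less.hyps[OF _ lin fin] by blast
      then show ?thesis using sc by (intro bexI[of _ "s \<otimes> w"]) (auto simp: f'_def act_mult)
    qed
  qed
  then show thesis using that by blast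
qed

text \<open>
  Sum the height, which is positive on positive roots, over the finite group
  \<open>plane_fixer \<alpha> \<beta>\<close>. The result is invariant under the reflections in \<open>\<alpha>\<close> and \<open>\<beta>\<close>, hence
  vanishes on these roots, and only the finitely many positive roots that some group element
  makes negative can spoil its positivity.
\<close>

lemma plane_functional:
  assumes r: "\<alpha> \<in> roots" "\<beta> \<in> roots" and c: "\<bar>bil \<alpha> \<beta>\<bar> < 1"
  obtains f where "functional f" "finite {\<gamma> \<in> roots. pos \<gamma> \<and> f \<gamma> \<le> 0}" "f \<alpha> = 0" "f \<beta> = 0"
proof -
  let ?K = "plane_fixer \<alpha> \<beta>"
  have K: "finite ?K" by (rule finite_plane_fixer[OF assms])
  have Kc: "k \<in> carrier W" if "k \<in> ?K" for k using that by (simp add: plane_fixer_def)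
  define f where "f = (\<lambda>v. \<Sum>k\<in>?K. \<Sum>q\<in>S. act k v q)"
  have lin: "functional f" unfolding functional_def
  proof (intro allI)
    fix x u y v
    have "f (comb x u y v) = (\<Sum>k\<in>?K. \<Sum>q\<in>S. x * act k u q + y * act k v q)"
      unfolding f_def by (intro sum.cong) (simp_all add: Kc act_comb comb_apply)
    then show "f (comb x u y v) = x * f u + y * f v"
      by (simp add: f_def sum.distrib sum_distrib_left)
  qed
  have vanish: "f \<gamma> = 0" if \<gamma>: "\<gamma> \<in> {\<alpha>, \<beta>}" for \<gamma>
  proof -
    have \<gamma>r: "\<gamma> \<in> roots" using \<gamma> r by auto
    obtain \<rho> where \<rho>: "\<rho> \<in> carrier W" "\<And>v. act \<rho> v = reflect \<gamma> v" using reflection_exists[OF \<gamma>r] by blast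
    have closed: "k \<otimes> \<rho> \<in> ?K" if k: "k \<in> ?K" for k
    proof -
      have "\<exists>x y. act (k \<otimes> \<rho>) v = comb 1 v 1 (comb x \<alpha> y \<beta>)" for v
      proof -
        obtain x y where "act k (reflect \<gamma> v) = comb 1 (reflect \<gamma> v) 1 (comb x \<alpha> y \<beta>)"
          using k unfolding plane_fixer_def by blast
        then have e: "act (k \<otimes> \<rho>) v = comb 1 (reflect \<gamma> v) 1 (comb x \<alpha> y \<beta>)"
          using Kc[OF k] \<rho> by (simp add: act_mult)
        show ?thesis
        proof (cases "\<gamma> = \<alpha>")
          case True
          show ?thesis unfolding e True
            by (intro exI[of _ "x - 2 * bil \<alpha> v"] exI[of _ y] ext) (simp add: reflect_def comb_apply algebra_simps)
        next
          case False
          then have b: "\<gamma> = \<beta>" using \<gamma> by simp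
          show ?thesis unfolding e b
            by (intro exI[of _ x] exI[of _ "y - 2 * bil \<beta> v"] ext) (simp add: reflect_def comb_apply algebra_simps)
        qed
      qed
      then show ?thesis using Kc[OF k] \<rho>(1) by (simp add: plane_fixer_def)
    qed
    have invol: "k \<otimes> \<rho> \<otimes> \<rho> = k" if k: "k \<in> ?K" for k
    proof -
      have "\<rho> \<otimes> \<rho> = \<one>"
        by (rule eq_one_of_pos) (use \<rho> reflect_involution[OF root_norm[OF \<gamma>r]] in \<open>auto simp: act_mult\<close>)
      then show ?thesis using Kc[OF k] \<rho>(1) by (simp add: m_assoc)
    qed
    have "f (reflect \<gamma> \<gamma>) = (\<Sum>k\<in>?K. \<Sum>q\<in>S. act (k \<otimes> \<rho>) \<gamma> q)"
      unfolding f_def by (intro sum.cong) (simp_all add: Kc \<rho> act_mult)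
    also have "\<dots> = f \<gamma>" unfolding f_def
      by (rule sum.reindex_bij_witness[of _ "\<lambda>k. k \<otimes> \<rho>" "\<lambda>k. k \<otimes> \<rho>"]) (auto simp: closed invol)
    finally have "f (- \<gamma>) = f \<gamma>" using reflect_root_self[OF \<gamma>r] by simp
    then show ?thesis using functional_uminus[OF lin, of \<gamma>] by simp
  qed
  have one: "\<one> \<in> ?K"
  proof -
    have "act \<one> v = comb 1 v 1 (comb 0 \<alpha> 0 \<beta>)" for v by (rule ext) (simp add: comb_apply)
    then show ?thesis unfolding plane_fixer_def by blast
  qed
  have "{\<gamma> \<in> roots. pos \<gamma> \<and> f \<gamma> \<le> 0} \<subseteq> (\<Union>k\<in>?K. Inv (inv k))"
  proof
    fix \<gamma> assume "\<gamma> \<in> {\<gamma> \<in> roots. pos \<gamma> \<and> f \<gamma> \<le> 0}"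
    then have g: "\<gamma> \<in> roots" "pos \<gamma>" "f \<gamma> \<le> 0" by auto
    show "\<gamma> \<in> (\<Union>k\<in>?K. Inv (inv k))"
    proof (rule ccontr)
      assume "\<gamma> \<notin> (\<Union>k\<in>?K. Inv (inv k))"
      then have p: "pos (act k \<gamma>)" if "k \<in> ?K" for k
        using not_in_InvD[OF g(1,2), of "inv k"] Kc[OF that] that by auto
      have "0 < (\<Sum>q\<in>S. act k \<gamma> q)" if k: "k \<in> ?K" for k
      proof -
        have kr: "act k \<gamma> \<in> roots" using Kc[OF k] g by simp
        have "\<not> neg (act k \<gamma>)" using p[OF k] kr root_not_pos_neg by blast
        then obtain q where q: "0 < act k \<gamma> q" by (auto simp: neg_def not_le)
        then have "q \<in> S" using root_outside[OF kr] by force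
        then show ?thesis using q p[OF k] by (intro sum_pos2[of S q]) (auto simp: pos_def)
      qed
      then have "0 < f \<gamma>" unfolding f_def using K one by (intro sum_pos[of ?K]) auto
      then show False using g by simp
    qed
  qed
  then have "finite {\<gamma> \<in> roots. pos \<gamma> \<and> f \<gamma> \<le> 0}"
    by (rule finite_subset) (use K Kc in auto)
  then show thesis using that[OF lin] vanish by blast
qed

definition roots_on :: "'a set \<Rightarrow> ('a \<Rightarrow> real) set" where
  "roots_on J = {\<gamma> \<in> roots. \<forall>q. q \<notin> J \<longrightarrow> \<gamma> q = 0}"

text \<open>
  Translate a functional that vanishes on \<open>\<alpha>\<close> and \<open>\<beta>\<close> to a dominant one. The roots on which it
  then vanishes are those supported on the set \<open>J\<close> of simple roots on which it vanishes, and
  they are finitely many. So the pair \<open>\<alpha>\<close>, \<open>\<beta>\<close> is equivalent to a pair in one of the finitely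
  many finite subsystems \<open>roots_on J\<close>.
\<close>

lemma finite_bil_values: "finite {bil \<alpha> \<beta> | \<alpha> \<beta>. \<alpha> \<in> roots \<and> \<beta> \<in> roots \<and> \<bar>bil \<alpha> \<beta>\<bar> < 1}"
proof (rule finite_subset)
  let ?J = "{J \<in> Pow S. finite (roots_on J)}"
  let ?V = "\<Union>J\<in>?J. (\<lambda>(\<gamma>, \<delta>). bil \<gamma> \<delta>) ` (roots_on J \<times> roots_on J)"
  show "finite ?V" by auto
  show "{bil \<alpha> \<beta> | \<alpha> \<beta>. \<alpha> \<in> roots \<and> \<beta> \<in> roots \<and> \<bar>bil \<alpha> \<beta>\<bar> < 1} \<subseteq> ?V"
  proof safe
    fix \<alpha> \<beta> assume r: "\<alpha> \<in> roots" "\<beta> \<in> roots" and c: "\<bar>bil \<alpha> \<beta>\<bar> < 1"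
    obtain f where f: "functional f" "finite {\<gamma> \<in> roots. pos \<gamma> \<and> f \<gamma> \<le> 0}" "f \<alpha> = 0" "f \<beta> = 0"
      using plane_functional[OF r c] .
    obtain w where w: "w \<in> carrier W" "\<And>s. s \<in> S \<Longrightarrow> 0 \<le> f (act w (unit s))"
        "finite {\<gamma> \<in> roots. pos \<gamma> \<and> f (act w \<gamma>) \<le> 0}"
      using dominant_translate[OF f(1,2)] by blast
    define J where "J = {s \<in> S. f (act w (unit s)) = 0}"
    have lin: "functional (\<lambda>v. f (act w v))" using f(1) w(1) by (simp add: functional_def act_comb)
    have expand: "f (act w \<gamma>) = (\<Sum>s\<in>S. \<gamma> s * f (act w (unit s)))" if "\<gamma> \<in> roots" for \<gamma>
      by (rule functional_expand[OF lin finite_S]) (use root_outside that in blast)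
    have J_of_zero: "\<gamma> \<in> roots_on J" if \<gamma>: "\<gamma> \<in> roots" "pos \<gamma>" "f (act w \<gamma>) = 0" for \<gamma>
    proof -
      have "\<forall>s\<in>S. \<gamma> s * f (act w (unit s)) = 0"
        using expand[OF \<gamma>(1)] \<gamma>(2,3) w(2) by (subst sum_nonneg_eq_0_iff[symmetric]) (auto simp: pos_def)
      then show ?thesis using \<gamma>(1) root_outside by (auto simp: roots_on_def J_def)
    qed
    have J_of_zero': "\<gamma> \<in> roots_on J" if \<gamma>: "\<gamma> \<in> roots" "f (act w \<gamma>) = 0" for \<gamma>
    proof (cases "pos \<gamma>")
      case False
      then have "- \<gamma> \<in> roots_on J"
        using J_of_zero[of "- \<gamma>"] \<gamma> w(1) functional_uminus[OF f(1)] by (simp add: not_pos_iff act_uminus)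
      then show ?thesis using \<gamma>(1) by (simp add: roots_on_def)
    qed (use J_of_zero \<gamma> in blast)
    have "finite {\<gamma> \<in> roots. pos \<gamma> \<and> (\<forall>q. q \<notin> J \<longrightarrow> \<gamma> q = 0)}"
    proof (rule finite_subset[OF _ w(3)], safe)
      fix \<gamma> assume "\<gamma> \<in> roots" "\<forall>q. q \<notin> J \<longrightarrow> \<gamma> q = 0"
      then have "f (act w \<gamma>) = 0" by (subst expand) (auto simp: J_def intro!: sum.neutral)
      then show "f (act w \<gamma>) \<le> 0" by simp
    qed
    then have "finite (roots_on J)" unfolding roots_on_def by (rule finite_of_pos) simp
    then have J: "J \<in> ?J" by (auto simp: J_def)
    have "act (inv w) \<alpha> \<in> roots_on J" "act (inv w) \<beta> \<in> roots_on J"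
      using J_of_zero' r w(1) f(3,4) by simp_all
    moreover have "bil \<alpha> \<beta> = bil (act (inv w) \<alpha>) (act (inv w) \<beta>)" using w(1) by simp
    ultimately show "bil \<alpha> \<beta> \<in> ?V" using J by (intro UN_I[OF J]) force
  qed
qed

section \<open>Dominance and small roots\<close>

definition dominates :: "('a \<Rightarrow> real) \<Rightarrow> ('a \<Rightarrow> real) \<Rightarrow> bool" where
  "dominates \<beta> \<gamma> \<longleftrightarrow> (\<forall>w\<in>carrier W. neg (act w \<beta>) \<longrightarrow> neg (act w \<gamma>))"

lemma nonzero_coordinate:
  assumes "\<beta> \<in> roots" "pos \<beta>" obtains q where "0 < \<beta> q"
proof -
  have "\<not> neg \<beta>" using assms root_not_pos_neg by blast
  then show thesis using that by (auto simp: neg_def not_le)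
qed

text \<open>
  If \<open>w\<close> separates the two roots, then \<open>- w \<beta>\<close> and \<open>w \<gamma>\<close> are positive roots with inner product
  at most \<open>-1\<close>, and applying their reflections alternately produces infinitely many positive
  roots \<open>c (- w \<beta>) + d (w \<gamma>)\<close> with \<open>c > d \<ge> 0\<close>. Only finitely many positive roots are made
  negative by \<open>w\<inverse>\<close>, so \<open>d \<gamma> - c \<beta>\<close> is positive for one of these pairs.
\<close>

lemma separated_roots_ratio:
  assumes r: "\<beta> \<in> roots" "pos \<beta>" "\<gamma> \<in> roots" "pos \<gamma>" and b: "1 \<le> bil \<beta> \<gamma>"
    and w: "w \<in> carrier W" "neg (act w \<beta>)" "pos (act w \<gamma>)"
  shows "\<exists>\<kappa>>1. \<forall>q. \<kappa> * \<beta> q \<le> \<gamma> q"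
proof -
  define b where "b = bil \<beta> \<gamma>"
  have b1: "1 \<le> b" using assms(5) by (simp add: b_def)
  \<comment> \<open>The coefficients of \<open>- c \<beta> + d \<gamma>\<close> after the reflections in \<open>\<gamma>\<close> and then in \<open>\<beta>\<close>.\<close>
  define succ where "succ = (\<lambda>(c, d). (2 * b * (2 * b * c - d) - c, 2 * b * c - d))"
  define cd where "cd = (\<lambda>n. (succ ^^ n) (1 :: real, 0 :: real))"
  define c where "c = (\<lambda>n. fst (cd n))"
  define d where "d = (\<lambda>n. snd (cd n))"
  have cd0: "c 0 = 1" "d 0 = 0" by (simp_all add: c_def d_def cd_def)
  have step: "d (Suc n) = 2 * b * c n - d n" "c (Suc n) = 2 * b * d (Suc n) - c n" for n
    by (simp_all add: c_def d_def cd_def succ_def split: prod.splits)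
  have ineq: "0 \<le> d n \<and> d n < c n" for n
  proof (induction n)
    case (Suc n)
    then have "2 * c n \<le> 2 * b * c n" using b1 by simp
    then have 1: "c n < d (Suc n)" using Suc step(1)[of n] by linarith
    then have "2 * d (Suc n) \<le> 2 * b * d (Suc n)" using b1 Suc by simp
    then show ?case using 1 Suc step(2)[of n] by linarith
  qed (simp add: cd0)
  have incr: "c n < d (Suc n)" "d n < d (Suc n)" "c n < c (Suc n)" for n
  proof -
    have "2 * c n \<le> 2 * b * c n" using b1 ineq[of n] by simp
    then show "c n < d (Suc n)" using ineq[of n] step(1)[of n] by linarith
    then show "d n < d (Suc n)" "c n < c (Suc n)" using ineq[of n] ineq[of "Suc n"] by linarith+
  qed
  define \<theta> where "\<theta> = (\<lambda>n. comb (- c n) \<beta> (d n) \<gamma>)"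
  obtain \<rho> where \<rho>: "\<rho> \<in> carrier W" "\<And>v. act \<rho> v = reflect \<beta> v" using reflection_exists[OF r(1)] by blast
  obtain \<rho>' where \<rho>': "\<rho>' \<in> carrier W" "\<And>v. act \<rho>' v = reflect \<gamma> v" using reflection_exists[OF r(3)] by blast
  have \<theta>_root: "\<theta> n \<in> roots" for n
  proof (induction n)
    case 0
    have "\<theta> 0 = - \<beta>" by (rule ext) (simp add: \<theta>_def cd0 comb_apply)
    then show ?case using uminus_root[OF r(1)] by (simp only:)
  next
    case (Suc n)
    have "reflect \<gamma> (\<theta> n) = comb (- c n) \<beta> (d (Suc n)) \<gamma>"
      by (rule ext) (use r in \<open>simp add: reflect_def \<theta>_def bil_comb_right bil_sym[of \<gamma> \<beta>] b_def[symmetric] comb_apply step algebra_simps\<close>)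
    then have "reflect \<beta> (reflect \<gamma> (\<theta> n)) = \<theta> (Suc n)"
      by (intro ext) (use r in \<open>simp add: reflect_def \<theta>_def bil_comb_right b_def[symmetric] comb_apply step(2) algebra_simps\<close>)
    moreover have "act \<rho> (act \<rho>' (\<theta> n)) \<in> roots" using \<rho>(1) \<rho>'(1) Suc by simp
    ultimately show ?case by (simp add: \<rho> \<rho>')
  qed
  have act_\<theta>: "act w (\<theta> n) = comb (c n) (- act w \<beta>) (d n) (act w \<gamma>)" for n
  proof -
    have "act w (\<theta> n) = comb (- c n) (act w \<beta>) (d n) (act w \<gamma>)" using w by (simp add: \<theta>_def act_comb)
    then show ?thesis by (simp add: comb_def)
  qed
  have pos_\<theta>: "pos (act w (\<theta> n))" for n
    unfolding act_\<theta> using w ineq[of n] by (intro pos_comb) auto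
  have inj: "inj \<theta>"
  proof -
    obtain q where q: "0 < (- act w \<beta>) q"
      using nonzero_coordinate[of "- act w \<beta>"] r w by auto
    have "act w (\<theta> n) q < act w (\<theta> (Suc n)) q" for n
      unfolding act_\<theta> comb_apply
      using q w incr[of n] by (intro add_less_le_mono mult_strict_right_mono mult_right_mono) (auto simp: pos_def)
    then have mono: "strict_mono (\<lambda>n. act w (\<theta> n) q)" by (simp add: strict_mono_Suc_iff)
    show ?thesis
    proof (rule injI)
      fix n k assume "\<theta> n = \<theta> k"
      then have "act w (\<theta> n) q = act w (\<theta> k) q" by simp
      then show "n = k" using strict_mono_eq[OF mono] by blast
    qed
  qed
  have "\<exists>n. pos (\<theta> n)"
  proof (rule ccontr)
    assume "\<nexists>n. pos (\<theta> n)"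
    then have n: "neg (\<theta> n)" for n using \<theta>_root not_pos_iff by blast
    have "range (\<lambda>n. - \<theta> n) \<subseteq> Inv (inv w)"
      using n pos_\<theta> \<theta>_root w by (auto intro!: InvI simp: act_uminus)
    moreover have "inj (\<lambda>n. - \<theta> n)"
    proof (rule injI)
      fix n k assume "- \<theta> n = - \<theta> k"
      then have "(- \<theta> n) q = (- \<theta> k) q" for q by simp
      then have "\<theta> n = \<theta> k" by (intro ext) simp
      then show "n = k" using inj by (simp add: inj_eq)
    qed
    ultimately have "infinite (Inv (inv w))" using range_inj_infinite infinite_super by blast
    then show False using w(1) by simp
  qed
  then obtain n where n: "pos (\<theta> n)" by blast
  have "d n > 0"
  proof (rule ccontr)
    assume "\<not> d n > 0"
    then have "d n = 0" using ineq[of n] by linarith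
    then have "neg (\<theta> n)" using r(2) ineq[of n] by (simp add: \<theta>_def neg_def comb_apply pos_def)
    then show False using n \<theta>_root root_not_pos_neg by blast
  qed
  moreover have "c n * \<beta> q \<le> d n * \<gamma> q" for q using n by (simp add: \<theta>_def pos_def comb_apply)
  ultimately have "c n / d n * \<beta> q \<le> \<gamma> q" for q by (simp add: divide_simps mult.commute)
  moreover have "c n / d n > 1" using ineq[of n] \<open>d n > 0\<close> by simp
  ultimately show ?thesis by blast
qed

text \<open>
  If neither root dominates the other, each exceeds a multiple greater than \<open>1\<close> of the other.
\<close>

lemma dominance:
  assumes r: "\<beta> \<in> roots" "pos \<beta>" "\<gamma> \<in> roots" "pos \<gamma>" and b: "1 \<le> bil \<beta> \<gamma>"
  shows "dominates \<beta> \<gamma> \<or> dominates \<gamma> \<beta>"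
proof (rule ccontr)
  assume "\<not> ?thesis"
  then obtain w w' where w: "w \<in> carrier W" "neg (act w \<beta>)" "\<not> neg (act w \<gamma>)"
    "w' \<in> carrier W" "neg (act w' \<gamma>)" "\<not> neg (act w' \<beta>)" by (auto simp: dominates_def)
  obtain \<kappa> where \<kappa>: "\<kappa> > 1" "\<And>q. \<kappa> * \<beta> q \<le> \<gamma> q"
    using separated_roots_ratio[OF r b w(1,2)] w r not_neg_iff by auto
  obtain \<kappa>' where \<kappa>': "\<kappa>' > 1" "\<And>q. \<kappa>' * \<gamma> q \<le> \<beta> q"
    using separated_roots_ratio[OF r(3,4,1,2) _ w(4,5)] w r b not_neg_iff bil_sym[of \<beta> \<gamma>] by auto
  obtain q where q: "0 < \<beta> q" using nonzero_coordinate[OF r(1,2)] .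
  have "\<beta> q < \<kappa> * \<beta> q" using \<kappa>(1) q by simp
  also have "\<dots> \<le> \<gamma> q" by (rule \<kappa>(2))
  also have "\<dots> \<le> \<kappa>' * \<gamma> q" using mult_right_mono[of 1 \<kappa>' "\<gamma> q"] \<kappa>'(1) r(4) by (simp add: pos_def)
  also have "\<dots> \<le> \<beta> q" by (rule \<kappa>'(2))
  finally show False by simp
qed

definition small_roots :: "('a \<Rightarrow> real) set" where
  "small_roots = {\<beta> \<in> roots. pos \<beta> \<and> (\<forall>\<gamma>\<in>roots. pos \<gamma> \<and> dominates \<beta> \<gamma> \<longrightarrow> \<gamma> = \<beta>)}"

lemma small_rootsD:
  assumes "\<beta> \<in> small_roots" shows "\<beta> \<in> roots" "pos \<beta>"
    "\<And>\<gamma>. \<gamma> \<in> roots \<Longrightarrow> pos \<gamma> \<Longrightarrow> dominates \<beta> \<gamma> \<Longrightarrow> \<gamma> = \<beta>"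
  using assms by (auto simp: small_roots_def)

lemma elementary_subset_small: "elementary \<subseteq> small_roots"
proof
  fix \<beta> assume "\<beta> \<in> elementary"
  then obtain g v where g: "g \<in> carrier W" "v \<in> carrier W" "Inv g \<inter> Inv v = {\<beta>}"
    by (auto simp: elementary_def)
  then have \<beta>: "\<beta> \<in> Inv g" "\<beta> \<in> Inv v" by auto
  have "\<gamma> = \<beta>" if \<gamma>: "\<gamma> \<in> roots" "pos \<gamma>" "dominates \<beta> \<gamma>" for \<gamma>
  proof -
    have "\<gamma> \<in> Inv g" "\<gamma> \<in> Inv v"
      using \<gamma> InvD(3)[OF \<beta>(1)] InvD(3)[OF \<beta>(2)] g by (auto simp: dominates_def intro!: InvI)
    then have "\<gamma> \<in> {\<beta>}" unfolding g(3)[symmetric] by (rule IntI)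
    then show ?thesis by simp
  qed
  then show "\<beta> \<in> small_roots" using InvD[OF \<beta>(1)] by (auto simp: small_roots_def)
qed

lemma small_roots_bil: "\<beta> \<in> small_roots \<Longrightarrow> \<gamma> \<in> small_roots \<Longrightarrow> 1 \<le> bil \<beta> \<gamma> \<Longrightarrow> \<beta> = \<gamma>"
  using dominance[of \<beta> \<gamma>] small_rootsD by metis

lemma unit_small: assumes s: "s \<in> S" shows "unit s \<in> small_roots"
proof -
  have "\<gamma> = unit s" if \<gamma>: "\<gamma> \<in> roots" "pos \<gamma>" "dominates (unit s) \<gamma>" for \<gamma>
  proof -
    have "neg (act s (unit s))" using s by (simp add: act_S reflect_unit_self)
    then have "neg (act s \<gamma>)" using \<gamma>(3) s S_carrier by (simp add: dominates_def)
    then show ?thesis using simple_neg \<gamma> s by blast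
  qed
  then show ?thesis using s by (auto simp: small_roots_def)
qed

text \<open>
  Take \<open>r\<close> to be the last letter of a shortest \<open>w\<close> that makes \<open>\<beta>\<close> negative. That \<open>w r\<close> still
  makes \<open>\<beta>\<close> positive forces the inner product of \<open>\<beta>\<close> with \<open>\<alpha>\<^sub>r\<close> to be positive. A root
  dominated by \<open>r \<beta>\<close> is mapped by \<open>r\<close> to one dominated by \<open>\<beta>\<close>, except for \<open>\<alpha>\<^sub>r\<close> itself; but if
  \<open>r \<beta>\<close> dominated \<open>\<alpha>\<^sub>r\<close>, every element that makes \<open>\<beta>\<close> negative would make \<open>\<alpha>\<^sub>r\<close> positive, and
  the reflection in \<open>\<beta>\<close> does not.
\<close>

lemma small_root_descent:
  assumes \<beta>: "\<beta> \<in> small_roots" "\<beta> \<notin> unit ` S" and w: "w \<in> carrier W" "neg (act w \<beta>)"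
  obtains r w' where "r \<in> S" "w' \<in> carrier W" "len w' < len w" "reflect (unit r) \<beta> \<in> small_roots"
    "0 < bil (unit r) \<beta>" "bil (unit r) \<beta> < 1" "neg (act w' (reflect (unit r) \<beta>))"
proof -
  note b = small_rootsD[OF \<beta>(1)]
  obtain w0 where w0: "w0 \<in> carrier W" "neg (act w0 \<beta>)" "len w0 \<le> len w"
    and min: "\<And>u. u \<in> carrier W \<Longrightarrow> neg (act u \<beta>) \<Longrightarrow> len w0 \<le> len u"
    using ex_has_least_nat[of "\<lambda>u. u \<in> carrier W \<and> neg (act u \<beta>)" w len] w by blast
  have "w0 \<noteq> \<one>" using w0(2) b root_not_pos_neg by auto
  then obtain r where r: "descent w0 r" using exists_descent w0(1) by blast
  note d = descentD[OF r w0(1)]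
  have rc: "r \<in> carrier W" using d S_carrier by simp
  have rr: "act r (act r v) = v" for v using act_inv(1)[OF rc, of v] d by simp
  define w' where "w' = w0 \<otimes> r"
  have w': "w' \<in> carrier W" "len w' < len w" using w0 d rc by (auto simp: w'_def)
  have n: "neg (act w' (reflect (unit r) \<beta>))"
    using w0 d rc rr[of \<beta>] by (simp add: w'_def act_mult act_S[symmetric])
  have p: "pos (act w' \<beta>)"
    using min[of w'] w' w0 d b(1) not_neg_iff[of "act w' \<beta>"] by (force simp: w'_def)
  have pr: "pos (act w' (unit r))"
    using r w0 d act_mult_S_unit[of w0 r] by (simp add: w'_def descent_def)
  have k: "0 < bil (unit r) \<beta>"
  proof (rule ccontr)
    assume "\<not> 0 < bil (unit r) \<beta>"
    then have "pos (comb 1 (act w' \<beta>) (-2 * bil (unit r) \<beta>) (act w' (unit r)))"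
      using p pr by (intro pos_comb) auto
    then have "pos (act w' (reflect (unit r) \<beta>))" using w' by (simp add: reflect_def act_comb)
    moreover have "act w' (reflect (unit r) \<beta>) \<in> roots" using w' d rc b by (simp add: act_S[symmetric])
    ultimately show False using n root_not_pos_neg by blast
  qed
  have k1: "bil (unit r) \<beta> < 1"
  proof (rule ccontr)
    assume "\<not> bil (unit r) \<beta> < 1"
    then have "unit r = \<beta>" using small_roots_bil[OF unit_small[OF d(1)] \<beta>(1)] by simp
    then show False using \<beta>(2) d(1) by blast
  qed
  define \<beta>' where "\<beta>' = act r \<beta>"
  have \<beta>'r: "\<beta>' \<in> roots" using b rc by (simp add: \<beta>'_def)
  have "\<not> neg \<beta>'" using simple_neg[OF b(1,2) d(1)] \<beta>(2) d(1) by (auto simp: \<beta>'_def)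
  then have \<beta>'p: "pos \<beta>'" using \<beta>'r not_neg_iff by blast
  have "\<gamma> = \<beta>'" if \<gamma>: "\<gamma> \<in> roots" "pos \<gamma>" "dominates \<beta>' \<gamma>" for \<gamma>
  proof (cases "\<gamma> = unit r")
    case True
    obtain \<rho> where \<rho>: "\<rho> \<in> carrier W" "\<And>v. act \<rho> v = reflect \<beta> v" using reflection_exists[OF b(1)] by blast
    have "neg (act (\<rho> \<otimes> r) \<beta>')"
      using \<rho> rc rr[of \<beta>] b by (simp add: act_mult \<beta>'_def reflect_root_self)
    then have "neg (act (\<rho> \<otimes> r) (unit r))" using \<gamma>(3) True \<rho> rc by (simp add: dominates_def)
    then have "neg (act \<rho> (- unit r))" using \<rho> rc d by (simp add: act_mult act_S reflect_unit_self)
    then have "pos (act \<rho> (unit r))" unfolding act_uminus[OF \<rho>(1)] by simp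
    then have "pos (reflect \<beta> (unit r))" by (simp only: \<rho>(2))
    then have ge: "0 \<le> unit r q - 2 * (bil (unit r) \<beta> * \<beta> q)" for q
      by (simp add: reflect_def pos_def comb_apply bil_sym[of \<beta> "unit r"] mult.assoc)
    have "\<beta> q \<le> 0" if "q \<noteq> r" for q
      using ge[of q] that k by (simp add: unit_apply mult_le_0_iff)
    then have z: "\<beta> q = 0" if "q \<noteq> r" for q using that b(2) by (auto simp: pos_def intro: antisym)
    have "\<beta> = comb (\<beta> r) (unit r) 0 (unit r)"
    proof
      fix q show "\<beta> q = comb (\<beta> r) (unit r) 0 (unit r) q"
        by (cases "q = r") (simp_all add: comb_apply unit_apply z)
    qed
    then have "\<beta> = unit r" using proportional_roots[of \<beta> "unit r" "\<beta> r"] b d(1) by (simp add: pos_def)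
    then show ?thesis using \<beta>(2) d(1) by blast
  next
    case False
    have r\<gamma>: "act r \<gamma> \<in> roots" using \<gamma> rc by simp
    have "pos (act r \<gamma>)" using simple_neg[OF \<gamma>(1,2) d(1)] False r\<gamma> not_neg_iff by blast
    moreover have "dominates \<beta> (act r \<gamma>)" unfolding dominates_def
    proof (intro ballI impI)
      fix u assume u: "u \<in> carrier W" "neg (act u \<beta>)"
      then have "neg (act (u \<otimes> r) \<beta>')" using rc rr[of \<beta>] by (simp add: act_mult \<beta>'_def)
      then have "neg (act (u \<otimes> r) \<gamma>)" using \<gamma>(3) u rc by (simp add: dominates_def)
      then show "neg (act u (act r \<gamma>))" using u rc by (simp add: act_mult)
    qed
    ultimately have "act r \<gamma> = \<beta>" using b(3) r\<gamma> by blast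
    then show ?thesis using rr[of \<gamma>] by (simp add: \<beta>'_def)
  qed
  then have "\<beta>' \<in> small_roots" using \<beta>'r \<beta>'p by (auto simp: small_roots_def)
  then have "reflect (unit r) \<beta> \<in> small_roots" using d(1) by (simp add: \<beta>'_def act_S)
  then show thesis using that d(1) w' k k1 n by blast
qed

text \<open>
  Ascents from a simple root through small roots. A negative inner product makes the step go
  up, and the lower bound \<open>-1\<close> is forced: beyond it the reflected root would dominate the
  simple root.
\<close>

definition chain :: "nat \<Rightarrow> (nat \<Rightarrow> 'a \<Rightarrow> real) \<Rightarrow> bool" where
  "chain k c \<longleftrightarrow> c 0 \<in> unit ` S \<and> (\<forall>i\<le>k. c i \<in> small_roots) \<and>
     (\<forall>i<k. \<exists>r\<in>S. c (Suc i) = reflect (unit r) (c i) \<and> -1 < bil (unit r) (c i) \<and> bil (unit r) (c i) < 0)"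

lemma chain_exists:
  assumes "\<beta> \<in> small_roots" "w \<in> carrier W" "neg (act w \<beta>)"
  shows "\<exists>k c. chain k c \<and> c k = \<beta>"
  using assms
proof (induction "len w" arbitrary: w \<beta> rule: less_induct)
  case less
  show ?case
  proof (cases "\<beta> \<in> unit ` S")
    case True
    then show ?thesis using less.prems(1) by (intro exI[of _ 0] exI[of _ "\<lambda>_. \<beta>"]) (simp add: chain_def)
  next
    case False
    obtain r w' where r: "r \<in> S" "w' \<in> carrier W" "len w' < len w" "reflect (unit r) \<beta> \<in> small_roots"
      "0 < bil (unit r) \<beta>" "bil (unit r) \<beta> < 1" "neg (act w' (reflect (unit r) \<beta>))"
      using small_root_descent[OF less.prems(1) False less.prems(2,3)] .
    obtain k c where c: "chain k c" "c k = reflect (unit r) \<beta>"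
      using less.hyps[OF r(3,4,2,7)] by blast
    have "bil (unit r) (reflect (unit r) \<beta>) = - bil (unit r) \<beta>"
      using r(1) by (simp add: reflect_def bil_comb_right)
    moreover have "reflect (unit r) (reflect (unit r) \<beta>) = \<beta>" using r(1) by (simp add: reflect_involution)
    ultimately have "\<exists>r\<in>S. \<beta> = reflect (unit r) (c k) \<and> -1 < bil (unit r) (c k) \<and> bil (unit r) (c k) < 0"
      using r c(2) by (intro bexI[OF _ r(1)]) auto
    then have "chain (Suc k) (c(Suc k := \<beta>))"
      using c(1) less.prems(1) by (auto simp: chain_def less_Suc_eq le_Suc_eq)
    then show ?thesis by (intro exI[of _ "Suc k"] exI[of _ "c(Suc k := \<beta>)"]) simp
  qed
qed

text \<open>
  Reflections in simple roots other than \<open>\<alpha>\<^sub>s\<close> add positive multiples of simple roots that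
  have nonpositive inner product with \<open>\<alpha>\<^sub>s\<close>, and the reflection in \<open>\<alpha>\<^sub>s\<close> is no step of a chain
  while the inner product is at most \<open>-1\<close>.
\<close>

lemma chain_frozen:
  assumes "chain k c" "i \<le> j" "j \<le> k" "s \<in> S" "bil (unit s) (c i) \<le> -1"
  shows "bil (unit s) (c j) \<le> -1 \<and> c j s = c i s"
  using assms(2,3)
proof (induction j rule: dec_induct)
  case (step j)
  then have IH: "bil (unit s) (c j) \<le> -1" "c j s = c i s" by auto
  obtain r where r: "r \<in> S" "c (Suc j) = reflect (unit r) (c j)" "-1 < bil (unit r) (c j)" "bil (unit r) (c j) < 0"
    using assms(1) step.prems unfolding chain_def by (meson Suc_le_lessD)
  have rs: "r \<noteq> s" using r(3) IH(1) by auto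
  have "bil (unit s) (c (Suc j)) = bil (unit s) (c j) - 2 * (bil (unit r) (c j) * entry s r)"
    using r assms(4) by (simp add: reflect_def bil_comb_right bil_unit_unit)
  moreover have "0 \<le> bil (unit r) (c j) * entry s r"
    using r entry_nonpos[OF assms(4) r(1)] rs by (intro mult_nonpos_nonpos) auto
  moreover have "c (Suc j) s = c j s" using r(2) rs by (simp add: reflect_def comb_apply unit_apply)
  ultimately show ?case using IH by simp
qed (use assms in simp)

lemma chain_height:
  assumes "chain k c" "i < j" "j \<le> k" shows "sum (c i) S < sum (c j) S"
proof -
  have *: "sum (c n) S < sum (c (Suc n)) S" if n: "n < k" for n
  proof -
    obtain r where r: "r \<in> S" "c (Suc n) = reflect (unit r) (c n)" "bil (unit r) (c n) < 0"
      using assms(1) n unfolding chain_def by blast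
    have "sum (unit r) S = 1" using r(1) by (simp add: unit_def)
    then have "sum (c (Suc n)) S = sum (c n) S - 2 * bil (unit r) (c n)"
      unfolding r(2) reflect_def comb_def sum.distrib sum_distrib_left[symmetric] by simp
    then show ?thesis using r by simp
  qed
  show ?thesis using assms(2,3)
  proof (induction j)
    case (Suc j)
    then show ?case using *[of j] by (cases "i = j") auto
  qed simp
qed

text \<open>
  Record for each simple root its inner product with the members of a chain, with all values
  \<open>\<le> -1\<close> replaced by \<open>-1\<close>; finitely many records are possible. If \<open>\<beta>\<close> and a later \<open>\<beta>'\<close> have
  the same record, then \<open>\<beta>' - \<beta>\<close> involves only simple roots with which \<open>\<beta>\<close> and \<open>\<beta>'\<close> have equal
  inner products, because the other coordinates are frozen. So \<open>\<beta>' - \<beta>\<close> has the same inner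
  product with both, which means that \<open>bil \<beta> \<beta>' = 1\<close> and contradicts smallness. Chains are
  therefore bounded in length.
\<close>

lemma finite_small_roots: "finite small_roots"
proof -
  define V where "V = {bil \<alpha> \<beta> | \<alpha> \<beta>. \<alpha> \<in> roots \<and> \<beta> \<in> roots \<and> \<bar>bil \<alpha> \<beta>\<bar> < 1} \<union> {-1, 1}"
  define Pat where "Pat = PiE S (\<lambda>_. V)"
  have fP: "finite Pat" using finite_bil_values by (simp add: Pat_def V_def finite_PiE)
  have bound: "k < card Pat" if ch: "chain k c" for k c
  proof -
    define p where "p = (\<lambda>i. \<lambda>s\<in>S. if bil (unit s) (c i) \<le> -1 then -1 else bil (unit s) (c i))"
    have small: "c i \<in> small_roots" if "i \<le> k" for i using ch that by (simp add: chain_def)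
    have "p ` {..k} \<subseteq> Pat"
      unfolding Pat_def
    proof (intro image_subsetI PiE_I)
      fix i s assume i: "i \<in> {..k}" and s: "s \<in> S"
      note D = small_rootsD[OF small, of i]
      show "p i s \<in> V"
      proof (cases "1 \<le> bil (unit s) (c i)")
        case True
        then have "c i = unit s" using small_roots_bil[OF unit_small[OF s] small] i by force
        then show ?thesis using s by (simp add: p_def V_def)
      next
        case False
        have "c i \<in> roots" using D i by simp
        then have "bil (unit s) (c i) \<in> V" if "\<not> bil (unit s) (c i) \<le> -1"
          unfolding V_def using False unit_root[OF s] that
          by (intro UnI1 CollectI exI[of _ "unit s"] exI[of _ "c i"]) auto
        moreover have "-1 \<in> V" by (simp add: V_def)
        ultimately show ?thesis using s by (simp add: p_def)
      qed
    qed (simp add: p_def)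
    moreover have "inj_on p {..k}"
    proof (rule linorder_inj_onI)
      fix i j assume ij: "i < j" "i \<in> {..k}" "j \<in> {..k}"
      show "p i \<noteq> p j"
      proof
        assume e: "p i = p j"
        have "(c j s - c i s) * bil (unit s) (c i) = (c j s - c i s) * bil (unit s) (c j)" if s: "s \<in> S" for s
        proof (cases "bil (unit s) (c i) \<le> -1")
          case True
          then have "c j s = c i s" using chain_frozen[OF ch _ _ s True, of j] ij by simp
          then show ?thesis by simp
        next
          case False
          then show ?thesis using fun_cong[OF e, of s] s by (auto simp: p_def split: if_splits)
        qed
        then have "bil (comb 1 (c j) (-1) (c i)) (c i) = bil (comb 1 (c j) (-1) (c i)) (c j)"
          unfolding bil_expand[of "comb 1 (c j) (-1) (c i)"] by (intro sum.cong) (simp_all add: comb_apply)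
        moreover have "bil (c i) (c i) = 1" "bil (c j) (c j) = 1"
          using small_rootsD(1)[OF small] ij by simp_all
        ultimately have "bil (c i) (c j) = 1" by (simp add: bil_comb_left bil_sym[of "c j" "c i"])
        then have "c i = c j" using small_roots_bil[OF small small] ij by simp
        then show False using chain_height[OF ch ij(1)] ij by simp
      qed
    qed auto
    ultimately have "card {..k} \<le> card Pat" using fP card_inj_on_le by blast
    then show ?thesis by simp
  qed
  \<comment> \<open>\<open>L n\<close> collects the images of simple roots under words of length \<open>n\<close>.\<close>
  define L where "L = rec_nat (unit ` S) (\<lambda>_ X. (\<lambda>(r, v). reflect (unit r) v) ` (S \<times> X))"
  have L: "L 0 = unit ` S" "L (Suc n) = (\<lambda>(r, v). reflect (unit r) v) ` (S \<times> L n)" for n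
    by (simp_all add: L_def)
  have fL: "finite (L n)" for n by (induction n) (simp_all add: L)
  have inL: "i \<le> k \<Longrightarrow> c i \<in> L i" if ch: "chain k c" for k c i
  proof (induction i)
    case (Suc i)
    then obtain r where "r \<in> S" "c (Suc i) = reflect (unit r) (c i)"
      using ch unfolding chain_def by (meson Suc_le_lessD)
    then show ?case using Suc by (auto simp: L)
  qed (use ch in \<open>simp add: L chain_def\<close>)
  have "small_roots \<subseteq> (\<Union>k<card Pat. L k)"
  proof
    fix \<beta> assume b: "\<beta> \<in> small_roots"
    obtain v s where v: "v \<in> carrier W" "s \<in> S" "\<beta> = act v (unit s)"
      using small_rootsD(1)[OF b] by (auto simp: roots_def)
    then have "neg (act (s \<otimes> inv v) \<beta>)" using S_carrier by (simp add: act_mult act_S reflect_unit_self)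
    then obtain k c where "chain k c" "c k = \<beta>"
      using chain_exists[OF b, of "s \<otimes> inv v"] v S_carrier by auto
    then show "\<beta> \<in> (\<Union>k<card Pat. L k)" using inL[of k c k] bound by auto
  qed
  then show ?thesis by (rule finite_subset) (use fL in simp)
qed

lemma finite_elementary: "finite elementary"
  by (rule finite_subset[OF elementary_subset_small finite_small_roots])

lemma finite_smallest_garside_shadow: "finite (smallest_garside_shadow W S)"
proof (rule finite_subset)
  show "smallest_garside_shadow W S \<subseteq> {g. gate g}"
    using garside_shadow_gates unfolding smallest_garside_shadow_def by blast
qed (rule finite_gates[OF finite_elementary])

end

theorem corollary1p2:
  fixes W :: "('a, 'b) monoid_scheme" and S :: "'a set"
  assumes "coxeter_system W S"
    and "finite S"
  shows "finite (smallest_garside_shadow W S)"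
proof -
  obtain m where "coxeter_matrix S m" "has_presentation W S (coxeter_relators S m)"
    using assms(1) by (auto simp: coxeter_system_def)
  then interpret coxeter W S m using assms(2) by unfold_locales
  show ?thesis by (rule finite_smallest_garside_shadow)
qed

end
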